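(* Let $K$ be a complete, algebraically closed nonarchimedean valued field and let $\varphi(z)\in K(z)$ have degree $d\ge1$. Then $\mathrm{Lip}_{\mathbf P^1(K)}(\varphi)=1/\mathrm{GPR}(\varphi)$.
   Context: $K$ is a complete, algebraically closed field with a nontrivial nonarchimedean absolute value $|\cdot|$. Fix $q>1$. $\mathbf P^1_{\mathrm{Berk}}$ is the Berkovich projective line over $K$ (a tree containing $\mathbf P^1(K)$); $\zeta_{a,r}$ ($a\in K$, $r>0$) is the point corresponding to the disc $D(a,r)$, $\zeta_G=\zeta_{0,1}$. On $\mathbf H^1=\mathbf P^1_{\mathrm{Berk}}\setminus\mathbf P^1(K)$, $\rho$ is the logarithmic path metric (the path $\{\zeta_{a,r}:R_1\le r\le R_2\}$ has length $\log_q(R_2/R_1)$), $\mathrm{diam}_G(x)=q^{-\rho(\zeta_G,x)}$ for $x\in\mathbf H^1$ and $0$ on $\mathbf P^1(K)$; explicitly $\mathrm{diam}_G(\zeta_{a,r})=r/\max(1,|a|,r)^2$. A nonconstant $\varphi\in K(z)$ acts on $\mathbf P^1_{\mathrm{Berk}}$ and $\varphi^{-1}(\zeta_G)$ is a finite nonempty subset of $\mathbf H^1$. Gauss Pre-Image radius: $\mathrm{GPR}(\varphi)=\min\{\mathrm{diam}_G(x):\varphi(x)=\zeta_G\}$. The spherical metric is $\|x,y\|=|x-y|/(\max(1,|x|)\max(1,|y|))$ for $x,y\in K$, $\|x,\infty\|=1/\max(1,|x|)$, and $\mathrm{Lip}_{\mathbf P^1(K)}(\varphi)=\sup_{x\ne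 y\in\mathbf P^1(K)}\|\varphi(x),\varphi(y)\|/\|x,y\|$. *)

theory Defs
  imports "HOL-Analysis.Analysis" "HOL-Computational_Algebra.Polynomial"
begin

definition nonarch_abs :: "('a::field \<Rightarrow> real) \<Rightarrow> bool" where
  "nonarch_abs absv \<longleftrightarrow>
     (\<forall>x. absv x \<ge> 0) \<and> (\<forall>x. absv x = 0 \<longleftrightarrow> x = 0) \<and>
     (\<forall>x y. absv (x * y) = absv x * absv y) \<and>
     (\<forall>x y. absv (x + y) \<le> max (absv x) (absv y))"

definition nontrivial_abs :: "('a::field \<Rightarrow> real) \<Rightarrow> bool" where
  "nontrivial_abs absv \<longleftrightarrow> (\<exists>x. x \<noteq> 0 \<and> absv x \<noteq> 1)"

definition complete_abs :: "('a::field \<Rightarrow> real) \<Rightarrow> bool" where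
  "complete_abs absv \<longleftrightarrow>
     (\<forall>X :: nat \<Rightarrow> 'a.
        (\<forall>e>0. \<exists>N. \<forall>m\<ge>N. \<forall>n\<ge>N. absv (X m - X n) < e) \<longrightarrow>
        (\<exists>L. (\<lambda>n. absv (X n - L)) \<longlonglongrightarrow> 0))"

definition alg_closed :: "'a::field itself \<Rightarrow> bool" where
  "alg_closed _ \<longleftrightarrow> (\<forall>p :: 'a poly. degree p \<ge> 1 \<longrightarrow> (\<exists>x. poly p x = 0))"

text \<open>P^1(K) is modelled as 'a option: Some x is x in K, None is infinity.\<close>

fun sph :: "('a::field \<Rightarrow> real) \<Rightarrow> 'a option \<Rightarrow> 'a option \<Rightarrow> real" where
  "sph absv (Some x) (Some y) = absv (x - y) / (max 1 (absv x) * max 1 (absv y))"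
| "sph absv (Some x) None = 1 / max 1 (absv x)"
| "sph absv None (Some y) = 1 / max 1 (absv y)"
| "sph absv None None = 0"

text \<open>phi = P/Q with P, Q coprime, Q nonzero.\<close>

fun rat_eval :: "'a::field poly \<Rightarrow> 'a poly \<Rightarrow> 'a option \<Rightarrow> 'a option" where
  "rat_eval P Q (Some x) =
     (if poly Q x = 0 then None else Some (poly P x / poly Q x))"
| "rat_eval P Q None =
     (if degree P > degree Q then None
      else Some (coeff P (degree Q) / coeff Q (degree Q)))"

definition Lip_P1 :: "('a::field \<Rightarrow> real) \<Rightarrow> 'a poly \<Rightarrow> 'a poly \<Rightarrow> ereal" where
  "Lip_P1 absv P Q =
     (SUP xy \<in> {(x, y). x \<noteq> y}.
        ereal (sph absv (rat_eval P Q (fst xy)) (rat_eval P Q (snd xy)) /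
               sph absv (fst xy) (snd xy)))"

definition berk_pt :: "('a::field \<Rightarrow> real) \<Rightarrow> ('a poly \<Rightarrow> real) \<Rightarrow> bool" where
  "berk_pt absv s \<longleftrightarrow>
     (\<forall>c. s [:c:] = absv c) \<and>
     (\<forall>f. s f \<ge> 0) \<and>
     (\<forall>f g. s (f * g) = s f * s g) \<and>
     (\<forall>f g. s (f + g) \<le> s f + s g)"

definition type_I :: "('a::field \<Rightarrow> real) \<Rightarrow> ('a poly \<Rightarrow> real) \<Rightarrow> bool" where
  "type_I absv s \<longleftrightarrow> (\<exists>a. \<forall>g. s g = absv (poly g a))"

text \<open>H^1 = P^1_Berk minus P^1(K) (infinity is a type I point of P^1, not in A^1_Berk).\<close>

definition H1 :: "('a::field \<Rightarrow> real) \<Rightarrow> ('a poly \<Rightarrow> real) set" where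
  "H1 absv = {s. berk_pt absv s \<and> \<not> type_I absv s}"

definition gauss_pt :: "('a::field \<Rightarrow> real) \<Rightarrow> 'a poly \<Rightarrow> real" where
  "gauss_pt absv g = Max ((\<lambda>i. absv (coeff g i)) ` {0..degree g})"

text \<open>Homogenised composition: g(P/Q) * Q^(deg g).\<close>

definition hcomp :: "'a::field poly \<Rightarrow> 'a poly \<Rightarrow> 'a poly \<Rightarrow> 'a poly" where
  "hcomp g P Q = (\<Sum>i\<le>degree g. smult (coeff g i) (P ^ i * Q ^ (degree g - i)))"

text \<open>Action of phi = P/Q on x in H^1: [g]_{phi(x)} = [g o phi]_x, where the
  norm [.]_x is extended multiplicatively to K(T).\<close>

definition berk_act :: "'a::field poly \<Rightarrow> 'a poly \<Rightarrow> ('a poly \<Rightarrow> real) \<Rightarrow> ('a poly \<Rightarrow> real)" where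
  "berk_act P Q s = (\<lambda>g. s (hcomp g P Q) / s Q ^ degree g)"

text \<open>diam_G on H^1. On zeta_{a,r} it equals r / max(1,|a|,r)^2, since
  inf_b [T-b] = r and [T] = max(|a|,r); for type IV points it is the continuous extension.\<close>

definition diam_G :: "('a::field \<Rightarrow> real) \<Rightarrow> ('a poly \<Rightarrow> real) \<Rightarrow> real" where
  "diam_G absv s = (INF b. s [:-b, 1:]) / (max 1 (s [:0, 1:]))\<^sup>2"

definition GPR :: "('a::field \<Rightarrow> real) \<Rightarrow> 'a poly \<Rightarrow> 'a poly \<Rightarrow> real" where
  "GPR absv P Q = Inf (diam_G absv ` {s \<in> H1 absv. berk_act P Q s = gauss_pt absv})"

end

theory Submission
  imports Defs
begin

text \<open>Writing \<open>\<phi> = P/Q\<close>, a point \<open>s\<close> of the Berkovich line lies over the Gauss point iff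
  \<open>s (u P + v Q) = max |u| |v| * s Q\<close> for all scalars \<open>u, v\<close>; such \<open>s\<close> are called balanced below.

  Lower bound for the Lipschitz constant: if \<open>s\<close> is balanced, two points \<open>x, y\<close> of \<open>K\<close> that are
  generic for \<open>s\<close> have images at spherical distance nearly 1, while their own distance is nearly
  \<open>diam_G s\<close>. Genericity is only approximate, so that all types of points are treated alike.

  Upper bound: suppose \<open>x, y\<close> lie in the unit disc and put
  \<open>R = |x - y| / \<parallel>\<phi> x, \<phi> y\<parallel>\<close>. After a unimodular change of coordinates in the target,
  \<open>\<phi> x = 0\<close>. Either \<open>\<phi>\<close> has a pole in \<open>D(x, R)\<close>, or the Schwarz lemma makes the norm of \<open>\<phi>\<close> at
  \<open>\<zeta>(x, R)\<close> at least 1. In both cases a path of discs inside \<open>D(x, R)\<close> leads from a point with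
  \<open>|\<phi>| < 1\<close> to one with \<open>|\<phi>| \<ge> 1\<close> (or from \<open>|\<phi>| > 1\<close> to \<open>|\<phi>| \<le> 1\<close>), and the first crossing is
  balanced, with \<open>diam_G\<close> at most \<open>R\<close>. The inversion \<open>z \<mapsto> 1/z\<close> takes care of the complement of the
  unit disc, and points on different sides have distance 1.\<close>

section \<open>Nonarchimedean absolute values on algebraically closed fields\<close>

lemma ultrametric_add_eq:
  fixes N :: "'b::ab_group_add \<Rightarrow> real"
  assumes add: "\<And>x y. N (x + y) \<le> max (N x) (N y)" and minus: "\<And>x. N (- x) = N x"
    and less: "N x < N y"
  shows "N (x + y) = N y"
  using add[of x y] add[of "x + y" "- x"] minus[of x] less by (auto simp: max_def split: if_splits)

locale nonarch_acf =
  fixes absv :: "'a::field \<Rightarrow> real"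
  assumes nonarch: "nonarch_abs absv"
    and nontrivial: "nontrivial_abs absv"
    and closed: "alg_closed TYPE('a)"
begin

lemma absv_nonneg [simp]: "0 \<le> absv x"
  and absv_eq_0_iff [simp]: "absv x = 0 \<longleftrightarrow> x = 0"
  and absv_mult: "absv (x * y) = absv x * absv y"
  and absv_add: "absv (x + y) \<le> max (absv x) (absv y)"
  using nonarch unfolding nonarch_abs_def by auto

lemma absv_0 [simp]: "absv 0 = 0"
  by simp

lemma absv_pos_iff [simp]: "0 < absv x \<longleftrightarrow> x \<noteq> 0"
  using absv_nonneg[of x] absv_eq_0_iff[of x] by linarith

lemma absv_le_0_iff [simp]: "absv x \<le> 0 \<longleftrightarrow> x = 0"
  using absv_nonneg[of x] absv_eq_0_iff[of x] by linarith

lemma absv_1 [simp]: "absv 1 = 1"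
  using absv_mult[of 1 1] absv_eq_0_iff[of 1] by simp

lemma absv_minus [simp]: "absv (- x) = absv x"
proof -
  have "absv (-1) * absv (-1) = 1"
    using absv_mult[of "-1" "-1"] by simp
  hence "absv (-1) = 1"
    using absv_nonneg[of "-1"] by (metis abs_of_nonneg abs_1 real_sqrt_abs2 real_sqrt_one)
  thus ?thesis
    using absv_mult[of "-1" x] by simp
qed

lemma absv_power: "absv (x ^ n) = absv x ^ n"
  by (induction n) (auto simp: absv_mult)

lemma absv_divide: "absv (x / y) = absv x / absv y"
proof (cases "y = 0")
  case False
  thus ?thesis
    using absv_mult[of "x / y" y] by (simp add: field_simps)
qed simp

lemma absv_diff: "absv (x - y) \<le> max (absv x) (absv y)"
  using absv_add[of x "- y"] by simp

lemma absv_diff_commute: "absv (x - y) = absv (y - x)"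
  using absv_minus[of "x - y"] by simp

lemma absv_triangle: "absv (x - z) \<le> max (absv (x - y)) (absv (y - z))"
  using absv_add[of "x - y" "y - z"] by simp

lemma absv_add_eq: "absv x < absv y \<Longrightarrow> absv (x + y) = absv y"
  by (rule ultrametric_add_eq[of absv]) (auto simp: absv_add)

lemma absv_of_nat_le_1: "absv (of_nat n) \<le> 1"
proof (induction n)
  case (Suc n)
  thus ?case using absv_add[of 1 "of_nat n"] by simp
qed simp

lemma absv_sum_le:
  assumes "0 \<le> B" "\<And>i. i \<in> I \<Longrightarrow> absv (f i) \<le> B"
  shows "absv (\<Sum>i\<in>I. f i) \<le> B"
  using assms
proof (induction I rule: infinite_finite_induct)
  case (insert i I)
  have "absv (f i) \<le> B" "absv (sum f I) \<le> B"
    using insert by auto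
  thus ?case
    using absv_add[of "f i" "sum f I"] insert.hyps by simp
qed auto

lemma absv_sum_less:
  assumes "0 < B" "\<And>i. i \<in> I \<Longrightarrow> absv (f i) < B"
  shows "absv (\<Sum>i\<in>I. f i) < B"
  using assms
proof (induction I rule: infinite_finite_induct)
  case (insert i I)
  have "absv (f i) < B" "absv (sum f I) < B"
    using insert by auto
  thus ?case
    using absv_add[of "f i" "sum f I"] insert.hyps by simp
qed auto

text \<open>Every polynomial is a constant times linear factors, so a property compatible with
  products need only be checked on constants and on \<open>[:-b, 1:]\<close>.\<close>

lemma poly_root_induct_closed [case_names const linear]:
  assumes const: "\<And>c. R [:c:]"
    and linear: "\<And>b f. f \<noteq> 0 \<Longrightarrow> R f \<Longrightarrow> R ([:-b, 1:] * f)"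
  shows "R (f :: 'a poly)"
proof (induction "degree f" arbitrary: f rule: less_induct)
  case less
  show ?case
  proof (cases "degree f = 0")
    case True
    then obtain c where "f = [:c:]" by (rule degree_eq_zeroE)
    thus ?thesis using const by simp
  next
    case False
    then obtain b where "poly f b = 0"
      using closed unfolding alg_closed_def by (metis One_nat_def Suc_leI gr0I)
    then obtain g where g: "f = [:-b, 1:] * g"
      by (auto simp: poly_eq_0_iff_dvd dvd_def)
    with False have "g \<noteq> 0" by auto
    moreover from this have "degree g < degree f"
      unfolding g by (subst degree_mult_eq) auto
    ultimately show ?thesis
      using less linear g by blast
  qed
qed

lemma ex_root:
  assumes "0 < degree (f :: 'a poly)"
  obtains b where "poly f b = 0"
  using closed assms unfolding alg_closed_def by (metis One_nat_def Suc_leI)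

text \<open>A root of \<open>\<Prod>(X - b) - 1\<close>, so only units occur among the differences \<open>u - b\<close>.\<close>

lemma ex_unit_distant:
  assumes "finite B"
  obtains u where "absv u \<le> 1" "\<And>b. b \<in> B \<Longrightarrow> 1 \<le> absv (u - b)"
proof -
  define B' where "B' = insert 0 {b \<in> B. absv b \<le> 1}"
  have fin: "finite B'" and B': "\<And>b. b \<in> B' \<Longrightarrow> absv b \<le> 1"
    using assms by (auto simp: B'_def)
  define f where "f = (\<Prod>b\<in>B'. [:-b, 1:])"
  have "degree f = card B'"
    unfolding f_def by (subst degree_prod_eq_sum_degree) auto
  hence "0 < degree (f + [:-1:])"
    using fin by (subst degree_add_eq_left) (auto simp: B'_def card_gt_0_iff)
  then obtain u where "poly (f + [:-1:]) u = 0"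
    by (rule ex_root)
  hence "(\<Prod>b\<in>B'. (u - b)) = 1"
    by (simp add: f_def poly_prod)
  moreover have absv_prod: "absv (prod g A) = (\<Prod>b\<in>A. absv (g b))" for g :: "'a \<Rightarrow> 'a" and A
    by (induction A rule: infinite_finite_induct) (auto simp: absv_mult)
  ultimately have prod1: "(\<Prod>b\<in>B'. absv (u - b)) = 1"
    by (metis absv_1)
  have u: "absv u \<le> 1"
  proof (rule ccontr)
    assume "\<not> absv u \<le> 1"
    hence "absv (u - b) = absv u" if "b \<in> B'" for b
      using B'[OF that] absv_add_eq[of "-b" u] by simp
    hence "absv u ^ card B' = 1"
      using prod1 by simp
    thus False
      using \<open>\<not> absv u \<le> 1\<close> fin one_less_power[of "absv u" "card B'"]
      by (auto simp: B'_def card_gt_0_iff)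
  qed
  have le1: "absv (u - b) \<le> 1" if "b \<in> B'" for b
    using absv_diff[of u b] u B'[OF that] by simp
  show ?thesis
  proof (rule that[OF u])
    fix b assume b: "b \<in> B"
    show "1 \<le> absv (u - b)"
    proof (cases "absv b \<le> 1")
      case True
      hence bB: "b \<in> B'" using b by (simp add: B'_def)
      have "1 = absv (u - b) * (\<Prod>b\<in>B' - {b}. absv (u - b))"
        using prod1 prod.remove[OF fin bB, of "\<lambda>b. absv (u - b)"] by simp
      also have "\<dots> \<le> absv (u - b) * 1"
        using le1 by (intro mult_left_mono prod_le_1) auto
      finally show ?thesis by simp
    next
      case False
      thus ?thesis using absv_add_eq[of u "-b"] u by simp
    qed
  qed
qed

text \<open>For large \<open>n\<close>, an \<open>n\<close>-th root of an element of absolute value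
  above 1 has absolute value between 1 and \<open>1 / t\<close>; its consecutive powers are then too
  close together to skip the interval from \<open>t * R\<close> to \<open>R\<close>.\<close>

lemma value_group_dense:
  assumes "0 < R" "0 < t" "t < 1"
  obtains w where "w \<noteq> 0" "t * R < absv w" "absv w \<le> R"
proof -
  obtain z where z: "1 < absv z"
  proof -
    obtain x where "x \<noteq> 0" "absv x \<noteq> 1"
      using nontrivial unfolding nontrivial_abs_def by auto
    thus ?thesis
      using that[of x] that[of "1 / x"] absv_divide[of 1 x]
      by (cases "1 < absv x") (auto simp: field_simps)
  qed
  obtain n where n: "absv z < (1 / t) ^ n"
    using real_arch_pow[of "1 / t" "absv z"] assms by auto
  with z have n0: "n \<noteq> 0" by (intro notI) auto
  have "degree (monom 1 n + [:-z:]) = n"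
    using n0 by (subst degree_add_eq_left) (auto simp: degree_monom_eq)
  then obtain w where "poly (monom 1 n + [:-z:]) w = 0"
    using ex_root[of "monom 1 n + [:-z:]"] n0 by auto
  hence w: "absv w ^ n = absv z"
    by (simp add: poly_monom flip: absv_power)
  have w1: "1 < absv w"
    using w z n0 by (metis absv_nonneg linorder_not_le power_le_one)
  have w2: "absv w < 1 / t"
    using w n assms by (metis absv_nonneg power_less_imp_less_base divide_nonneg_nonneg less_imp_le zero_le_one)
  \<comment> \<open>The largest exponent for which the power of \<open>absv w\<close> does not
    exceed \<open>R\<close>; one further factor, less than \<open>1 / t\<close>, overshoots.\<close>
  define k where "k = \<lfloor>log (absv w) R\<rfloor>"
  have wR: "absv w powr (log (absv w) R) = R"
    using w1 assms by (intro powr_log_cancel) linarith+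
  have up: "absv w powr (real_of_int k) \<le> R"
    using w1 wR powr_mono[of "real_of_int k" "log (absv w) R" "absv w"] by (simp add: k_def)
  have "R < absv w powr (real_of_int k + 1)"
    using w1 wR powr_less_mono[of "log (absv w) R" "real_of_int k + 1" "absv w"] by (simp add: k_def)
  hence "R < absv w powr (real_of_int k) * absv w"
    using w1 by (simp add: powr_add)
  also have "\<dots> < absv w powr (real_of_int k) * (1 / t)"
    using w1 w2 by (intro mult_strict_left_mono) auto
  finally have low: "t * R < absv w powr (real_of_int k)"
    using assms by (simp add: field_simps)
  have "absv (w powi k) = absv w powr (real_of_int k)"
  proof -
    have "absv (w powi k) = absv w powi k"
      using absv_divide[of 1] by (auto simp: power_int_def absv_power inverse_eq_divide)
    thus ?thesis using w1 powr_real_of_int'[of "absv w" k] by linarith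
  qed
  with up low have "t * R < absv (w powi k)" "absv (w powi k) \<le> R" by auto
  moreover from this have "w powi k \<noteq> 0" 
    using w1 by auto
  ultimately show ?thesis using that by blast
qed

subsection \<open>Gauss norms and disc points\<close>


text \<open>The norm attached to the disc of radius \<open>r\<close> about 0. Radius 0 is allowed:
  since \<open>0 ^ 0 = 1\<close>, it yields \<open>absv (poly f 0)\<close>, so that paths of discs
  can start at points of \<open>K\<close>.\<close>

definition gnorm :: "real \<Rightarrow> 'a poly \<Rightarrow> real" where
  "gnorm r f = Max ((\<lambda>i. absv (coeff f i) * r ^ i) ` {..degree f})"

lemma gnorm_attained: "\<exists>i\<le>degree f. gnorm r f = absv (coeff f i) * r ^ i"
proof -
  have "gnorm r f \<in> (\<lambda>i. absv (coeff f i) * r ^ i) ` {..degree f}"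
    unfolding gnorm_def by (intro Max_in) auto
  thus ?thesis by auto
qed

lemma gnorm_nonneg: "0 \<le> r \<Longrightarrow> 0 \<le> gnorm r f"
  using gnorm_attained[of f r] by auto

lemma gnorm_ge: "0 \<le> r \<Longrightarrow> absv (coeff f i) * r ^ i \<le> gnorm r f"
proof (cases "i \<le> degree f")
  case True
  thus ?thesis unfolding gnorm_def by (intro Max_ge) auto
qed (auto simp: coeff_eq_0 gnorm_nonneg)

lemma gnorm_le: "(\<And>i. absv (coeff f i) * r ^ i \<le> M) \<Longrightarrow> gnorm r f \<le> M"
  using gnorm_attained[of f r] by auto

lemma gnorm_0 [simp]: "gnorm r 0 = 0"
  by (simp add: gnorm_def)

lemma gnorm_const: "gnorm r [:c:] = absv c"
  by (simp add: gnorm_def)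

lemma gnorm_linear: "gnorm r [:c, 1:] = max (absv c) r"
  by (simp add: gnorm_def atMost_Suc max.commute)

lemma gnorm_pos: "0 < r \<Longrightarrow> f \<noteq> 0 \<Longrightarrow> 0 < gnorm r f"
  by (rule less_le_trans[OF _ gnorm_ge[of r f "degree f"]]) auto

lemma gnorm_add:
  assumes "0 \<le> r"
  shows "gnorm r (f + g) \<le> max (gnorm r f) (gnorm r g)"
proof (rule gnorm_le)
  fix i
  have "absv (coeff (f + g) i) * r ^ i \<le> max (absv (coeff f i)) (absv (coeff g i)) * r ^ i"
    using assms by (intro mult_right_mono) (auto simp: absv_add)
  also have "\<dots> = max (absv (coeff f i) * r ^ i) (absv (coeff g i) * r ^ i)"
    using assms by (intro max_mult_distrib_right[THEN trans]) auto
  also have "\<dots> \<le> max (gnorm r f) (gnorm r g)"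
    using assms gnorm_ge by (intro max.mono)
  finally show "absv (coeff (f + g) i) * r ^ i \<le> max (gnorm r f) (gnorm r g)" .
qed

text \<open>The Horner form of the norm, from which continuity in \<open>r\<close> follows by
  induction on the coefficients.\<close>

lemma gnorm_pCons:
  assumes "0 \<le> r"
  shows "gnorm r (pCons c f) = max (absv c) (r * gnorm r f)"
proof (rule antisym)
  show "gnorm r (pCons c f) \<le> max (absv c) (r * gnorm r f)"
  proof (rule gnorm_le)
    fix i
    show "absv (coeff (pCons c f) i) * r ^ i \<le> max (absv c) (r * gnorm r f)"
    proof (cases i)
      case (Suc j)
      have "r * (absv (coeff f j) * r ^ j) \<le> r * gnorm r f"
        using assms gnorm_ge by (intro mult_left_mono)
      thus ?thesis by (simp add: Suc mult_ac le_max_iff_disj)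
    qed simp
  qed
  obtain i where "gnorm r f = absv (coeff f i) * r ^ i"
    using gnorm_attained by blast
  thus "max (absv c) (r * gnorm r f) \<le> gnorm r (pCons c f)"
    using gnorm_ge[OF assms, of "pCons c f" 0] gnorm_ge[OF assms, of "pCons c f" "Suc i"]
    by (simp add: mult_ac)
qed

lemma gnorm_first_attained:
  obtains i where "gnorm r f = absv (coeff f i) * r ^ i"
    "\<And>k. k < i \<Longrightarrow> absv (coeff f k) * r ^ k \<noteq> gnorm r f"
proof -
  define i where "i = (LEAST i. absv (coeff f i) * r ^ i = gnorm r f)"
  have ex: "\<exists>i. absv (coeff f i) * r ^ i = gnorm r f"
    using gnorm_attained[of f r] by auto
  have "absv (coeff f i) * r ^ i = gnorm r f"
    unfolding i_def using ex by (rule LeastI_ex)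
  moreover have "\<And>k. k < i \<Longrightarrow> absv (coeff f k) * r ^ k \<noteq> gnorm r f"
    unfolding i_def by (rule not_less_Least)
  ultimately show ?thesis using that by metis
qed

text \<open>Gauss's lemma. If \<open>i\<close> and \<open>j\<close> are the least indices where the
  two maxima are attained, the coefficient of degree \<open>i + j\<close> of the product has a
  single dominant term.\<close>

lemma gnorm_mult:
  assumes r: "0 < r"
  shows "gnorm r (f * g) = gnorm r f * gnorm r g"
proof (cases "f = 0 \<or> g = 0")
  case False
  hence pos: "0 < gnorm r f" "0 < gnorm r g"
    using gnorm_pos[OF r] by auto
  note ge = gnorm_ge[OF less_imp_le[OF r]]
  show ?thesis
  proof (rule antisym)
    show "gnorm r (f * g) \<le> gnorm r f * gnorm r g"
    proof (rule gnorm_le)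
      fix n
      have "absv (coeff f k * coeff g (n - k)) \<le> gnorm r f * gnorm r g / r ^ n" if "k \<le> n" for k
      proof -
        have "(absv (coeff f k) * r ^ k) * (absv (coeff g (n - k)) * r ^ (n - k)) \<le> gnorm r f * gnorm r g"
          using r pos by (intro mult_mono ge) auto
        moreover have "r ^ n = r ^ k * r ^ (n - k)"
          using that by (simp flip: power_add)
        ultimately show ?thesis
          using r by (simp add: absv_mult pos_le_divide_eq mult_ac)
      qed
      hence "absv (coeff (f * g) n) \<le> gnorm r f * gnorm r g / r ^ n"
        unfolding coeff_mult using r pos by (intro absv_sum_le) auto
      thus "absv (coeff (f * g) n) * r ^ n \<le> gnorm r f * gnorm r g"
        using r by (simp add: field_simps)
    qed
    obtain i where i: "gnorm r f = absv (coeff f i) * r ^ i"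
      "\<And>k. k < i \<Longrightarrow> absv (coeff f k) * r ^ k \<noteq> gnorm r f"
      by (rule gnorm_first_attained[of r f]) blast
    obtain j where j: "gnorm r g = absv (coeff g j) * r ^ j"
      "\<And>k. k < j \<Longrightarrow> absv (coeff g k) * r ^ k \<noteq> gnorm r g"
      by (rule gnorm_first_attained[of r g]) blast
    let ?t = "\<lambda>k. coeff f k * coeff g (i + j - k)"
    let ?B = "gnorm r f * gnorm r g / r ^ (i + j)"
    have B: "absv (?t i) = ?B"
      using r by (simp add: i(1) j(1) absv_mult power_add)
    have B_pos: "0 < ?B"
      using pos r by simp
    \<comment> \<open>Either \<open>k < i\<close> or the complementary index is below
      \<open>j\<close>, so minimality makes one of the two factors strictly smaller than its
      maximum.\<close>
    have "absv (?t k) < ?B" if k: "k \<in> {..i + j} - {i}" for k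
    proof -
      let ?a = "absv (coeff f k) * r ^ k" and ?b = "absv (coeff g (i + j - k)) * r ^ (i + j - k)"
      have "?a * ?b < gnorm r f * gnorm r g"
      proof (cases "k < i")
        case True
        hence "?a < gnorm r f"
          using ge[of f k] i(2) by (simp add: order.strict_iff_order)
        hence "?a * ?b \<le> ?a * gnorm r g" "?a * gnorm r g < gnorm r f * gnorm r g"
          using r pos ge[of g "i + j - k"] by (auto intro!: mult_left_mono)
        thus ?thesis by linarith
      next
        case False
        hence "?b < gnorm r g"
          using k ge[of g "i + j - k"] j(2)[of "i + j - k"] by fastforce
        hence "?a * ?b \<le> gnorm r f * ?b" "gnorm r f * ?b < gnorm r f * gnorm r g"
          using r pos ge[of f k] by (auto intro!: mult_right_mono)
        thus ?thesis by linarith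
      qed
      moreover have "r ^ (i + j) = r ^ k * r ^ (i + j - k)"
        using k by (simp flip: power_add)
      ultimately show ?thesis
        using r by (simp add: absv_mult pos_less_divide_eq mult_ac del: power_add)
    qed
    hence "absv (sum ?t ({..i + j} - {i})) < absv (?t i)"
      unfolding B using B_pos by (intro absv_sum_less) auto
    moreover have "coeff (f * g) (i + j) = sum ?t ({..i + j} - {i}) + ?t i"
      unfolding coeff_mult by (subst sum.remove[of _ i]) auto
    ultimately have "absv (coeff (f * g) (i + j)) = ?B"
      using B absv_add_eq by simp
    thus "gnorm r f * gnorm r g \<le> gnorm r (f * g)"
      using ge[of "f * g" "i + j"] r by simp
  qed
qed auto

lemma continuous_on_gnorm: "continuous_on {0..} (\<lambda>r. gnorm r f)"
proof (induction f)
  case (pCons c f)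
  have "continuous_on {0..} (\<lambda>r. max (absv c) (r * gnorm r f))"
    by (intro continuous_intros pCons.IH)
  thus ?case
    by (rule continuous_on_eq) (simp add: gnorm_pCons)
qed simp

lemma gauss_pt_eq_gnorm: "gauss_pt absv = gnorm 1"
  by (auto simp: gauss_pt_def gnorm_def atLeast0AtMost)

definition zeta :: "'a \<Rightarrow> real \<Rightarrow> 'a poly \<Rightarrow> real" where
  "zeta a r f = gnorm r (f \<circ>\<^sub>p [:a, 1:])"

lemma zeta_const [simp]: "zeta a r [:c:] = absv c"
  by (simp add: zeta_def gnorm_const pcompose_const)

lemma zeta_zero [simp]: "zeta a r 0 = 0"
  by (simp add: zeta_def)

lemma zeta_linear: "zeta a r [:-b, 1:] = max (absv (a - b)) r"
  by (simp add: zeta_def gnorm_linear pcompose_pCons)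

lemma zeta_nonneg: "0 \<le> r \<Longrightarrow> 0 \<le> zeta a r f"
  by (simp add: zeta_def gnorm_nonneg)

lemma zeta_pos: "0 < r \<Longrightarrow> f \<noteq> 0 \<Longrightarrow> 0 < zeta a r f"
  unfolding zeta_def by (rule gnorm_pos) (auto simp: pcompose_eq_0_iff)

lemma zeta_add: "0 \<le> r \<Longrightarrow> zeta a r (f + g) \<le> max (zeta a r f) (zeta a r g)"
  by (simp add: zeta_def pcompose_add gnorm_add)

lemma zeta_mult: "0 < r \<Longrightarrow> zeta a r (f * g) = zeta a r f * zeta a r g"
  by (simp add: zeta_def pcompose_mult gnorm_mult)

lemma zeta_0: "zeta a 0 f = absv (poly f a)"
proof -
  have "gnorm 0 g = absv (poly g 0)" for g
    by (cases g) (simp add: gnorm_pCons)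
  thus ?thesis by (simp add: zeta_def poly_pcompose)
qed

lemma continuous_on_zeta: "continuous_on {0..} (\<lambda>r. zeta a r f)"
  unfolding zeta_def by (rule continuous_on_gnorm)

lemma zeta_smult: "0 < r \<Longrightarrow> zeta a r (smult c f) = absv c * zeta a r f"
  using zeta_mult[of r a "[:c:]" f] by simp

text \<open>Every point of an ultrametric disc is a centre of it; by multiplicativity only linear
  factors have to be compared.\<close>

lemma zeta_change_center:
  assumes "0 < r" "absv (a - b) \<le> r"
  shows "zeta a r f = zeta b r f"
proof (induction f rule: poly_root_induct_closed)
  case (linear c f)
  have "max (absv (a - c)) r = max (absv (b - c)) r"
    using absv_triangle[of a c b] absv_triangle[of b c a] absv_diff_commute[of a b] assms by auto
  thus ?case
    using assms linear by (simp add: zeta_mult zeta_linear del: mult_pCons_left)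
qed simp

text \<open>A linear factor whose zero \<open>c\<close> lies outside the disc has the constant
  absolute value \<open>absv (a - c)\<close> on it.\<close>

lemma zeta_eq_absv_poly:
  assumes "0 < r" "absv (z - a) \<le> r" "\<And>b. poly f b = 0 \<Longrightarrow> r < absv (a - b)"
  shows "zeta a r f = absv (poly f z)"
  using assms(3)
proof (induction f rule: poly_root_induct_closed)
  case (linear c f)
  have c: "r < absv (a - c)"
    using linear.prems[of c] by (simp del: mult_pCons_left)
  hence "absv (z - c) = absv (a - c)"
    using absv_add_eq[of "z - a" "a - c"] assms(2) by simp
  thus ?case
    using c assms(1) linear.IH linear.prems
    by (simp add: zeta_mult zeta_linear absv_mult del: mult_pCons_left)
qed simp

text \<open>With \<open>z\<close> as the centre, \<open>poly f z\<close> is the constant coefficient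
  and hence one of the terms of the maximum.\<close>

lemma absv_poly_le_zeta:
  assumes "0 < r" "absv (z - a) \<le> r"
  shows "absv (poly f z) \<le> zeta a r f"
proof -
  have "absv (coeff (f \<circ>\<^sub>p [:z, 1:]) 0) * r ^ 0 \<le> zeta z r f"
    unfolding zeta_def using assms by (intro gnorm_ge) auto
  moreover have "coeff (f \<circ>\<^sub>p [:z, 1:]) 0 = poly f z"
    by (simp add: poly_pcompose flip: poly_0_coeff_0)
  ultimately show ?thesis
    using zeta_change_center[OF assms] by simp
qed

lemma zeta_mono:
  assumes "0 \<le> r" "r \<le> r'"
  shows "zeta a r f \<le> zeta a r' f"
proof -
  have "absv (coeff g i) * r ^ i \<le> gnorm r' g" for g i
    using assms gnorm_ge[of r' g i] mult_left_mono[OF power_mono[OF assms(2,1), of i], of "absv (coeff g i)"]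
    by auto
  thus ?thesis unfolding zeta_def by (rule gnorm_le)
qed

text \<open>The Schwarz lemma: dividing out the zero at \<open>a\<close> leaves a polynomial whose norm still grows.\<close>

lemma zeta_schwarz:
  assumes "0 < r" "r \<le> r'" "poly f a = 0"
  shows "r' * zeta a r f \<le> r * zeta a r' f"
proof -
  obtain g where g: "f = [:-a, 1:] * g"
    using assms(3) by (auto simp: poly_eq_0_iff_dvd dvd_def)
  have "zeta a t f = t * zeta a t g" if "0 < t" for t
    unfolding g using that by (simp add: zeta_mult zeta_linear del: mult_pCons_left)
  thus ?thesis
    using assms zeta_mono[of r r' a g] by (simp add: mult_left_mono)
qed

lemma berk_pt_zeta:
  assumes "0 < r"
  shows "berk_pt absv (zeta a r)"
proof -
  have "zeta a r (f + g) \<le> zeta a r f + zeta a r g" for f g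
    using zeta_add[of r a f g] zeta_nonneg[of r a f] zeta_nonneg[of r a g] assms by linarith
  thus ?thesis
    using assms by (simp add: berk_pt_def zeta_nonneg zeta_mult)
qed

text \<open>Evaluation at \<open>b\<close> would kill \<open>[:-b, 1:]\<close>, whose norm is at
  least \<open>r\<close>.\<close>

lemma zeta_in_H1: "0 < r \<Longrightarrow> zeta a r \<in> H1 absv"
proof -
  assume r: "0 < r"
  have "\<not> type_I absv (zeta a r)"
  proof
    assume "type_I absv (zeta a r)"
    then obtain b where "zeta a r [:-b, 1:] = absv (poly [:-b, 1:] b)"
      unfolding type_I_def by blast
    thus False using r by (simp add: zeta_linear)
  qed
  thus ?thesis using berk_pt_zeta[OF r] by (simp add: H1_def)
qed

subsection \<open>Points over the Gauss point\<close>


context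
  fixes s :: "'a poly \<Rightarrow> real"
  assumes s: "berk_pt absv s"
begin

lemma berk_const [simp]: "s [:c:] = absv c"
  and berk_nonneg: "0 \<le> s f"
  and berk_mult: "s (f * g) = s f * s g"
  and berk_add: "s (f + g) \<le> s f + s g"
  using s unfolding berk_pt_def by auto

lemma berk_smult: "s (smult c f) = absv c * s f"
  using berk_mult[of "[:c:]" f] by simp

lemma berk_minus: "s (- f) = s f"
  using berk_smult[of "-1" f] by simp

lemma berk_zero: "s 0 = 0"
  using berk_const[of 0] by simp

lemma berk_power: "s (f ^ n) = s f ^ n"
proof (induction n)
  case 0
  thus ?case using berk_const[of 1] by (simp add: one_pCons)
qed (simp add: berk_mult)

lemma berk_sum_le: "s (\<Sum>i\<in>I. f i) \<le> (\<Sum>i\<in>I. s (f i))"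
proof (induction I rule: infinite_finite_induct)
  case (insert i I)
  thus ?case using berk_add[of "f i" "sum f I"] by simp
qed (auto simp: berk_zero)

text \<open>Binomial coefficients have absolute value at most 1, so the \<open>n\<close>-th power of the left-hand
  side exceeds that of the right-hand side by a factor of at most \<open>n + 1\<close>.\<close>

lemma berk_ultra: "s (f + g) \<le> max (s f) (s g)"
proof (rule ccontr)
  define M where "M = max (s f) (s g)"
  assume "\<not> s (f + g) \<le> max (s f) (s g)"
  hence gt: "M < s (f + g)" unfolding M_def by linarith
  have M0: "0 \<le> M"
    using berk_nonneg[of f] by (simp add: M_def)
  have pow: "s (f + g) ^ n \<le> (real n + 1) * M ^ n" for n
  proof -
    have "s (f + g) ^ n = s (\<Sum>k\<le>n. of_nat (n choose k) * f ^ k * g ^ (n - k))"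
      by (simp flip: berk_power binomial_ring)
    also have "\<dots> \<le> (\<Sum>k\<le>n. s (of_nat (n choose k) * f ^ k * g ^ (n - k)))"
      by (rule berk_sum_le)
    also have "\<dots> \<le> (\<Sum>k\<le>n. M ^ n)"
    proof (rule sum_mono)
      fix k assume k: "k \<in> {..n}"
      have "s (of_nat (n choose k) * f ^ k * g ^ (n - k)) =
          absv (of_nat (n choose k)) * (s f ^ k * s g ^ (n - k))"
        by (simp add: berk_mult berk_power berk_smult of_nat_poly)
      also have "\<dots> \<le> 1 * (M ^ k * M ^ (n - k))"
        using absv_of_nat_le_1 berk_nonneg M0
        by (intro mult_mono power_mono) (auto simp: M_def)
      also have "\<dots> = M ^ n"
        using k by (simp flip: power_add)
      finally show "s (of_nat (n choose k) * f ^ k * g ^ (n - k)) \<le> M ^ n" .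
    qed
    finally show ?thesis by (simp add: add.commute)
  qed
  have M: "0 < M"
    using pow[of 1] gt M0 by (cases "M = 0") auto
  define h where "h = s (f + g) / M - 1"
  have h: "0 < h" using gt M by (simp add: h_def)
  have bound: "(1 + h) ^ n \<le> real n + 1" for n
    using pow[of n] M by (simp add: h_def power_divide field_simps)
  obtain n :: nat where n: "2 / h\<^sup>2 < real n"
    using reals_Archimedean2 by blast
  with h have n0: "0 < real n"
    by (meson divide_pos_pos less_trans zero_less_numeral zero_less_power)
  \<comment> \<open>Bernoulli's inequality at \<open>n\<close>, squared and compared with
    \<open>bound\<close> at \<open>2 * n\<close>, sets a quadratic function of \<open>n\<close>
    against a linear one; \<open>n\<close> was chosen so large that the quadratic term alone
    wins.\<close>
  have "(1 + real n * h)\<^sup>2 \<le> ((1 + h) ^ n)\<^sup>2"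
    using h Bernoulli_inequality[of h n] by (intro power_mono) auto
  also have "\<dots> \<le> real (2 * n) + 1"
    using bound[of "2 * n"] by (simp add: power_even_eq)
  finally have "real n * (real n * h\<^sup>2) + 2 * real n * h \<le> 2 * real n"
    by (simp add: power2_eq_square algebra_simps)
  moreover have "real n * 2 < real n * (real n * h\<^sup>2)"
    using n n0 h by (intro mult_strict_left_mono) (auto simp: field_simps)
  moreover have "0 < real n * h"
    using n0 h by simp
  ultimately show False by simp
qed

lemma berk_add_eq: "s f < s g \<Longrightarrow> s (f + g) = s g"
  by (rule ultrametric_add_eq[of s]) (auto simp: berk_ultra berk_minus)

lemma berk_linear_diff: "absv (x - y) \<le> max (s [:-x, 1:]) (s [:-y, 1:])"
  using berk_ultra[of "[:-y, 1:]" "- [:-x, 1:]"] berk_minus[of "[:-x, 1:]"] by (simp add: max.commute)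

lemma berk_linear_shift: "s [:-y, 1:] \<le> max (s [:-x, 1:]) (absv (x - y))"
  using berk_ultra[of "[:-x, 1:]" "[:x - y:]"] by simp

text \<open>\<open>g\<close> differs from the constant \<open>poly g a\<close> by a multiple of
  \<open>[:-a, 1:]\<close>, which has seminorm 0.\<close>

lemma type_I_if_root:
  assumes "s [:-a, 1:] = 0"
  shows "type_I absv s"
proof -
  have "s g = absv (poly g a)" for g
  proof -
    define h where "h = g - [:poly g a:]"
    have "poly h a = 0" by (simp add: h_def)
    then obtain k where "h = [:-a, 1:] * k"
      by (auto simp: poly_eq_0_iff_dvd dvd_def)
    hence h: "s h = 0"
      using assms by (simp add: berk_mult del: mult_pCons_left)
    have "g = h + [:poly g a:]" "[:poly g a:] = - h + g"
      by (simp_all add: h_def)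
    thus ?thesis
      using berk_add[of h "[:poly g a:]"] berk_add[of "- h" g] h berk_minus[of h]
      by (metis add_0 antisym berk_const)
  qed
  thus ?thesis unfolding type_I_def by blast
qed

end

lemma H1_imp_berk_pt: "s \<in> H1 absv \<Longrightarrow> berk_pt absv s"
  by (simp add: H1_def)

text \<open>Outside type I no linear factor has seminorm 0, so the seminorm is a norm. This
  justifies divisions such as the one by \<open>s Q\<close> in \<open>berk_act\<close>.\<close>

lemma H1_pos:
  assumes "s \<in> H1 absv" "f \<noteq> 0"
  shows "0 < s f"
  using assms(2)
proof (induction f rule: poly_root_induct_closed)
  case (const c)
  thus ?case using berk_const[OF H1_imp_berk_pt[OF assms(1)]] by simp
next
  case (linear b f)
  have "s [:-b, 1:] \<noteq> 0"
    using assms(1) type_I_if_root by (auto simp: H1_def)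
  thus ?case
    using linear berk_nonneg[OF H1_imp_berk_pt[OF assms(1)], of "[:-b, 1:]"]
    by (simp add: berk_mult[OF H1_imp_berk_pt[OF assms(1)]] del: mult_pCons_left)
qed

text \<open>The homogeneous form treats numerator and denominator alike, so it survives the passage
  from \<open>P / Q\<close> to \<open>Q / P\<close> and to translates by constants of absolute value
  at most 1.\<close>

definition balanced :: "'a poly \<Rightarrow> 'a poly \<Rightarrow> ('a poly \<Rightarrow> real) \<Rightarrow> bool" where
  "balanced P Q s \<longleftrightarrow> (\<forall>u v. s (smult u P + smult v Q) = max (absv u) (absv v) * s Q)"

lemma balancedD: "balanced P Q s \<Longrightarrow> s (smult u P + smult v Q) = max (absv u) (absv v) * s Q"
  by (simp add: balanced_def)

lemma balanced_eq: "balanced P Q s \<Longrightarrow> s P = s Q"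
  using balancedD[of P Q s 1 0] by simp

lemma balanced_swap:
  assumes "balanced P Q s"
  shows "balanced Q P s"
  unfolding balanced_def
proof (intro allI)
  fix u v
  show "s (smult u Q + smult v P) = max (absv u) (absv v) * s P"
    using balancedD[OF assms, of v u] balanced_eq[OF assms] by (simp add: add.commute max.commute)
qed

text \<open>The substitution of \<open>v + u * c\<close> for \<open>v\<close> is unimodular and
  preserves \<open>max (absv u) (absv v)\<close>.\<close>

lemma balanced_shear:
  assumes "balanced (P - smult c Q) Q s" "absv c \<le> 1"
  shows "balanced P Q s"
  unfolding balanced_def
proof (intro allI)
  fix u v
  have "smult u P + smult v Q = smult u (P - smult c Q) + smult (v + u * c) Q"
    by (simp add: smult_diff_right smult_add_left)
  hence eq: "s (smult u P + smult v Q) = max (absv u) (absv (v + u * c)) * s Q"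
    using balancedD[OF assms(1)] by simp
  have "absv (u * c) \<le> absv u"
    using assms(2) by (simp add: absv_mult mult_left_le)
  hence "max (absv u) (absv (v + u * c)) = max (absv u) (absv v)"
    using absv_add[of v "u * c"] absv_diff[of "v + u * c" "u * c"] by auto
  thus "s (smult u P + smult v Q) = max (absv u) (absv v) * s Q"
    using eq by simp
qed

lemma smult_sum_right: "smult c (\<Sum>i\<in>I. f i) = (\<Sum>i\<in>I. smult c (f i))"
  by (induction I rule: infinite_finite_induct) (auto simp: smult_add_right)

text \<open>Prepares root induction: homogenised composition turns each linear factor into a
  combination of \<open>P\<close> and \<open>Q\<close>, whose norm the balance condition
  prescribes.\<close>

lemma hcomp_linear_mult:
  assumes "f \<noteq> 0"
  shows "hcomp ([:-b, 1:] * f) P Q = (P - smult b Q) * hcomp f P Q"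
proof -
  let ?n = "degree f"
  have deg: "degree ([:-b, 1:] * f) = Suc ?n"
    using assms by (subst degree_mult_eq) auto
  have eq: "[:-b, 1:] * f = pCons 0 f - smult b f" by simp
  have 1: "(\<Sum>i\<le>Suc ?n. smult (coeff (pCons 0 f) i) (P ^ i * Q ^ (Suc ?n - i))) = P * hcomp f P Q"
    unfolding hcomp_def by (subst sum.atMost_Suc_shift) (simp add: sum_distrib_left mult_ac)
  have 2: "(\<Sum>i\<le>Suc ?n. smult (coeff f i) (P ^ i * Q ^ (Suc ?n - i))) = Q * hcomp f P Q"
    unfolding hcomp_def
    by (simp add: coeff_eq_0 sum_distrib_left Suc_diff_le mult_ac cong: sum.cong_simp)
  have "hcomp ([:-b, 1:] * f) P Q =
      (\<Sum>i\<le>Suc ?n. smult (coeff (pCons 0 f) i) (P ^ i * Q ^ (Suc ?n - i))) -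
      smult b (\<Sum>i\<le>Suc ?n. smult (coeff f i) (P ^ i * Q ^ (Suc ?n - i)))"
    unfolding hcomp_def deg unfolding eq
    by (simp only: coeff_diff coeff_smult smult_diff_left sum_subtractf smult_sum_right smult_smult)
  also have "\<dots> = (P - smult b Q) * hcomp f P Q"
    unfolding 1 2 by (simp add: algebra_simps)
  finally show ?thesis .
qed

text \<open>Testing on the polynomials \<open>[:c, 1:]\<close> already yields balance, after scaling
  by \<open>u\<close>. Conversely, balance gives the norm of each \<open>P - smult c Q\<close>, and
  Gauss's lemma multiplies these norms up.\<close>

lemma berk_act_eq_gauss_pt_iff:
  assumes s: "s \<in> H1 absv" and Q: "Q \<noteq> 0"
  shows "berk_act P Q s = gauss_pt absv \<longleftrightarrow> balanced P Q s"
proof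
  note b = H1_imp_berk_pt[OF s]
  have sQ: "0 < s Q" using s Q by (rule H1_pos)
  {
    assume act: "berk_act P Q s = gauss_pt absv"
    have lin: "s (P + smult c Q) = max 1 (absv c) * s Q" for c
    proof -
      have "hcomp [:c, 1:] P Q = P + smult c Q"
        by (simp add: hcomp_def add.commute)
      thus ?thesis
        using fun_cong[OF act, of "[:c, 1:]"] sQ
        by (simp add: berk_act_def gauss_pt_eq_gnorm gnorm_linear field_simps max.commute)
    qed
    show "balanced P Q s"
      unfolding balanced_def
    proof (intro allI)
      fix u v
      show "s (smult u P + smult v Q) = max (absv u) (absv v) * s Q"
      proof (cases "u = 0")
        case True
        thus ?thesis using berk_smult[OF b] by simp
      next
        case False
        hence "smult u P + smult v Q = smult u (P + smult (v / u) Q)"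
          by (simp add: smult_add_right)
        hence "s (smult u P + smult v Q) = absv u * (max 1 (absv (v / u)) * s Q)"
          by (simp only: berk_smult[OF b] lin)
        also have "absv u * (max 1 (absv (v / u)) * s Q) = max (absv u) (absv v) * s Q"
          using False by (auto simp: absv_divide max_def field_simps)
        finally show ?thesis .
      qed
    qed
  }
  {
    assume bal: "balanced P Q s"
    have "s (hcomp g P Q) = gnorm 1 g * s Q ^ degree g" for g
    proof (induction g rule: poly_root_induct_closed)
      case (const c)
      thus ?case
        using berk_const[OF b, of c] by (simp add: hcomp_def gnorm_const one_pCons)
    next
      case (linear c g)
      have "s (P - smult c Q) = max 1 (absv c) * s Q"
        using balancedD[OF bal, of 1 "- c"] by simp
      moreover have "degree ([:-c, 1:] * g) = Suc (degree g)"
        using linear by (subst degree_mult_eq) auto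
      ultimately show ?case
        using linear
        by (simp add: hcomp_linear_mult berk_mult[OF b] gnorm_mult gnorm_linear max.commute
            del: mult_pCons_left)
    qed
    thus "berk_act P Q s = gauss_pt absv"
      using sQ by (auto simp: berk_act_def gauss_pt_eq_gnorm)
  }
qed

text \<open>Just before the first radius at which \<open>P\<close> catches up with \<open>Q\<close>, the strict ultrametric
  inequality determines the norm of every combination of \<open>P\<close> and \<open>Q\<close>; continuity does the rest.\<close>

lemma ex_balanced_on_ray:
  assumes a: "absv (poly P a) < absv (poly Q a)" and R: "0 \<le> R" "zeta a R Q \<le> zeta a R P"
  obtains r where "0 < r" "r \<le> R" "balanced P Q (zeta a r)"
proof -
  define D where "D = (\<lambda>r. zeta a r P - zeta a r Q)"
  define S where "S = {r \<in> {0..R}. 0 \<le> D r}"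
  have cont: "continuous_on {0..R} (\<lambda>r. zeta a r f)" for f
    by (rule continuous_on_subset[OF continuous_on_zeta]) auto
  have contD: "continuous_on {0..R} D"
    unfolding D_def by (intro continuous_intros cont)
  have S_eq: "S = {0..R} \<inter> D -` {0..}"
    by (auto simp: S_def)
  have "closed S"
    unfolding S_eq by (intro continuous_closed_preimage contD) auto
  moreover have "S \<noteq> {}" "bdd_below S"
    using R by (auto simp: S_def D_def intro!: bdd_belowI[of _ 0])
  ultimately have "Inf S \<in> S"
    by (intro closed_contains_Inf)
  define r where "r = Inf S"
  have r: "0 \<le> r" "r \<le> R" "0 \<le> D r"
    using \<open>Inf S \<in> S\<close> by (auto simp: r_def S_def)
  have before: "D t < 0" if "0 \<le> t" "t < r" for t
    using that r cInf_lower[OF _ \<open>bdd_below S\<close>, of t] by (force simp: r_def S_def)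
  have "D 0 < 0"
    using a by (simp add: D_def zeta_0)
  with r have r0: "0 < r"
    by (cases "r = 0") auto
  have clos: "closure {0<..<r} = {0..r}"
    using r0 by simp
  have cont': "continuous_on {0..r} (\<lambda>r. zeta a r f)" for f
    by (rule continuous_on_subset[OF cont]) (use r in auto)
  \<comment> \<open>\<open>D\<close> is negative to the left of \<open>r\<close>, so continuity
    supplies the inequality opposite to \<open>0 \<le> D r\<close>.\<close>
  have "D r \<le> 0"
  proof (rule continuous_le_on_closure[of "{0<..<r}" D])
    show "continuous_on (closure {0<..<r}) D"
      unfolding clos D_def by (intro continuous_intros cont')
    show "r \<in> closure {0<..<r}"
      unfolding clos using r0 by simp
  qed (use before in \<open>auto intro: less_imp_le\<close>)
  hence eq: "zeta a r P = zeta a r Q"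
    using r by (simp add: D_def)
  have Q0: "Q \<noteq> 0"
    using a absv_nonneg[of "poly P a"] by (intro notI) simp
  have pos: "0 < zeta a t Q" if "0 < t" for t
    using that Q0 by (rule zeta_pos)
  have "balanced P Q (zeta a r)"
    unfolding balanced_def
  proof (intro allI)
    fix u v
    let ?f = "smult u P + smult v Q"
    \<comment> \<open>If \<open>u\<close> dominates, the two summands already have different norms
      at \<open>r\<close>, where \<open>P\<close> and \<open>Q\<close> agree. Otherwise they may tie
      at \<open>r\<close>, but for \<open>t < r\<close> the \<open>Q\<close> term is strictly
      larger, and the equality passes to the limit.\<close>
    consider "absv v < absv u" | "absv u \<le> absv v" "v \<noteq> 0" | "u = 0" "v = 0"
      by (metis absv_pos_iff absv_0 linorder_not_le order_le_less)
    thus "zeta a r ?f = max (absv u) (absv v) * zeta a r Q"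
    proof cases
      case 1
      hence "zeta a r (smult v Q) < zeta a r (smult u P)"
        using eq pos[OF r0] by (simp add: zeta_smult[OF r0])
      from berk_add_eq[OF berk_pt_zeta[OF r0] this] show ?thesis
        using 1 eq by (simp add: zeta_smult[OF r0] add.commute)
    next
      case 2
      have "zeta a t ?f - absv v * zeta a t Q = 0" if "t \<in> {0<..<r}" for t
      proof -
        have t: "0 < t" "D t < 0" using that before by auto
        have "absv u * zeta a t P \<le> absv v * zeta a t P"
          using 2 t zeta_nonneg by (intro mult_right_mono) auto
        also have "\<dots> < absv v * zeta a t Q"
          using 2 t by (intro mult_strict_left_mono) (auto simp: D_def)
        finally have "zeta a t (smult u P) < zeta a t (smult v Q)"
          using t by (simp add: zeta_smult)
        from berk_add_eq[OF berk_pt_zeta[OF t(1)] this] show ?thesis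
          using t by (simp add: zeta_smult)
      qed
      hence "zeta a r ?f - absv v * zeta a r Q = 0"
      proof (rule continuous_constant_on_closure[of "{0<..<r}"
            "\<lambda>t. zeta a t ?f - absv v * zeta a t Q", rotated])
        show "continuous_on (closure {0<..<r}) (\<lambda>t. zeta a t ?f - absv v * zeta a t Q)"
          unfolding clos by (intro continuous_intros cont')
        show "r \<in> closure {0<..<r}"
          unfolding clos using r0 by simp
      qed
      thus ?thesis using 2 by simp
    qed simp
  qed
  with r0 r show ?thesis using that by blast
qed

text \<open>Both zeros are centres of the same disc of radius \<open>R\<close>. The polynomial that
  dominates there starts out smaller at its own zero, so the ray from that zero contains a
  crossing.\<close>

lemma ex_balanced_between_zeros:
  assumes "poly A a = 0" "poly B b = 0" "absv (a - b) \<le> R"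
    and ncr: "\<And>x. \<not> (poly A x = 0 \<and> poly B x = 0)"
  obtains c r where "c = a \<or> c = b" "0 < r" "r \<le> R" "balanced A B (zeta c r)"
proof -
  have "a \<noteq> b" using assms by auto
  hence "0 < absv (a - b)" by simp
  with assms(3) have R: "0 < R" by linarith
  show ?thesis
  proof (cases "zeta a R B \<le> zeta a R A")
    case True
    have "absv (poly A a) < absv (poly B a)"
      using assms(1) ncr[of a] by simp
    then obtain r where "0 < r" "r \<le> R" "balanced A B (zeta a r)"
      by (rule ex_balanced_on_ray[OF _ less_imp_le[OF R] True])
    thus ?thesis using that[of a] by blast
  next
    case False
    hence "zeta b R A \<le> zeta b R B"
      using zeta_change_center[OF R assms(3)] by simp
    moreover have "absv (poly B b) < absv (poly A b)"
      using assms(2) ncr[of b] by simp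
    ultimately obtain r where "0 < r" "r \<le> R" "balanced B A (zeta b r)"
      using ex_balanced_on_ray[OF _ less_imp_le[OF R]] by blast
    thus ?thesis using that[of b] balanced_swap by blast
  qed
qed

text \<open>As the map sends \<open>x\<close> to 0, \<open>R\<close> is \<open>absv (x - y)\<close>
  divided by the spherical distance of the images. If \<open>P\<close> dominates at radius
  \<open>R\<close>, the ray from \<open>x\<close> has a crossing; otherwise \<open>Q\<close> has a
  zero in the disc, which is paired with \<open>x\<close>.\<close>

lemma ex_balanced_near_zero:
  assumes x: "poly P x = 0" and y: "poly P y \<noteq> 0"
    and ncr: "\<And>z. \<not> (poly P z = 0 \<and> poly Q z = 0)"
    and R: "R = absv (x - y) * max (absv (poly P y)) (absv (poly Q y)) / absv (poly P y)"
  obtains c r where "absv (c - x) \<le> R" "0 < r" "r \<le> R" "balanced P Q (zeta c r)"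
proof -
  have xy: "0 < absv (x - y)" using x y by auto
  have Py: "0 < absv (poly P y)" using y by simp
  have "absv (x - y) * absv (poly P y) \<le> absv (x - y) * max (absv (poly P y)) (absv (poly Q y))"
    by (intro mult_left_mono) auto
  hence le: "absv (x - y) \<le> R"
    unfolding R using Py by (simp only: pos_le_divide_eq)
  hence R0: "0 < R" using xy by linarith
  show ?thesis
  proof (cases "zeta x R Q \<le> zeta x R P")
    case True
    have "absv (poly P x) < absv (poly Q x)"
      using x ncr[of x] by simp
    then obtain r where "0 < r" "r \<le> R" "balanced P Q (zeta x r)"
      by (rule ex_balanced_on_ray[OF _ less_imp_le[OF R0] True])
    thus ?thesis using that[of x] R0 by simp
  next
    case False
    \<comment> \<open>Without such a zero, \<open>Q\<close> has constant absolute value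
      \<open>absv (poly Q y)\<close> on the disc. By the Schwarz lemma \<open>P\<close> grows by the
      factor \<open>R / absv (x - y)\<close> from a norm of at least \<open>absv (poly P y)\<close>,
      and so catches up with \<open>Q\<close>.\<close>
    have "\<exists>b. poly Q b = 0 \<and> absv (x - b) \<le> R"
    proof (rule ccontr)
      assume "\<nexists>b. poly Q b = 0 \<and> absv (x - b) \<le> R"
      hence Qy: "zeta x R Q = absv (poly Q y)"
        using R0 le by (intro zeta_eq_absv_poly) (auto simp: absv_diff_commute[of y x] not_le)
      have "absv (x - y) * absv (poly Q y) \<le> R * absv (poly P y)"
        using Py xy by (simp add: R mult_left_mono)
      hence "absv (poly Q y) \<le> R * absv (poly P y) / absv (x - y)"
        using xy by (simp only: pos_le_divide_eq mult.commute)
      also have "\<dots> \<le> R * zeta x (absv (x - y)) P / absv (x - y)"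
        using xy R0 by (intro divide_right_mono mult_left_mono absv_poly_le_zeta)
          (auto simp: absv_diff_commute[of y x])
      also have "\<dots> \<le> zeta x R P"
        using zeta_schwarz[OF xy le x] xy by (simp only: pos_divide_le_eq mult.commute)
      finally show False using False Qy by simp
    qed
    then obtain b where b: "poly Q b = 0" "absv (x - b) \<le> R" by blast
    obtain c r where "c = x \<or> c = b" "0 < r" "r \<le> R" "balanced P Q (zeta c r)"
      using ex_balanced_between_zeros[OF x b ncr] by blast
    thus ?thesis
      using that[of c r] b R0 by (auto simp: absv_diff_commute[of b x])
  qed
qed

subsection \<open>Spherical metric and inversion\<close>


text \<open>The point with homogeneous coordinates \<open>p\<close>, \<open>q\<close>. The pair of
  two zeros gets the default \<open>None\<close>; the distance formulas exclude it.\<close>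

definition proj :: "'a \<Rightarrow> 'a \<Rightarrow> 'a option" where
  "proj p q = (if q = 0 then None else Some (p / q))"

lemma proj_scale: "c \<noteq> 0 \<Longrightarrow> proj (c * p) (c * q) = proj p q"
  by (simp add: proj_def)

text \<open>The numerator is a determinant, which makes the formula uniform at infinity and
  symmetric in the two coordinates.\<close>

lemma sph_proj:
  assumes "p \<noteq> 0 \<or> q \<noteq> 0" "p' \<noteq> 0 \<or> q' \<noteq> 0"
  shows "sph absv (proj p q) (proj p' q') =
    absv (p * q' - p' * q) / (max (absv p) (absv q) * max (absv p') (absv q'))"
proof -
  have M: "max 1 (absv a / absv b) = max (absv a) (absv b) / absv b" if "b \<noteq> 0" for a b
    using that by (auto simp: max_def field_simps)
  consider "q = 0" "q' = 0" | "q = 0" "q' \<noteq> 0" | "q \<noteq> 0" "q' = 0" | "q \<noteq> 0" "q' \<noteq> 0" by blast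
  thus ?thesis
  proof cases
    case 4
    hence "p / q - p' / q' = (p * q' - p' * q) / (q * q')"
      by (simp add: field_simps)
    thus ?thesis using 4 by (simp add: proj_def M absv_divide absv_mult)
  qed (use assms in \<open>auto simp: proj_def M absv_divide absv_mult max.absorb1 max.absorb2\<close>)
qed

lemma sph_proj_le_1:
  assumes "p \<noteq> 0 \<or> q \<noteq> 0" "p' \<noteq> 0 \<or> q' \<noteq> 0"
  shows "sph absv (proj p q) (proj p' q') \<le> 1"
proof -
  let ?M = "max (absv p) (absv q)" and ?M' = "max (absv p') (absv q')"
  have pos: "0 < ?M" "0 < ?M'"
    using assms by (auto simp: less_max_iff_disj)
  have "absv (p * q') \<le> ?M * ?M'"
    unfolding absv_mult by (rule mult_mono) (auto simp: le_max_iff_disj)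
  moreover have "absv (p' * q) \<le> ?M * ?M'"
    unfolding absv_mult mult.commute[of "absv p'"] by (rule mult_mono) (auto simp: le_max_iff_disj)
  ultimately have "absv (p * q' - p' * q) \<le> ?M * ?M'"
    using absv_diff[of "p * q'" "p' * q"] by linarith
  thus ?thesis
    unfolding sph_proj[OF assms] using pos by simp
qed

lemma rat_eval_Some: "rat_eval P Q (Some x) = proj (poly P x) (poly Q x)"
  by (simp add: proj_def)

lemma rat_eval_None:
  assumes "Q \<noteq> 0"
  shows "rat_eval P Q None =
    proj (coeff P (max (degree P) (degree Q))) (coeff Q (max (degree P) (degree Q)))"
  using assms by (auto simp: proj_def coeff_eq_0 max_def)

text \<open>This is \<open>X ^ d * f (1 / X)\<close> when \<open>degree f \<le> d\<close>. Unlike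
  \<open>reflect_poly\<close>, reversal in a fixed degree is linear, so it can be applied to
  \<open>P\<close> and \<open>Q\<close> together.\<close>

definition reverse_poly :: "nat \<Rightarrow> 'a poly \<Rightarrow> 'a poly" where
  "reverse_poly d f = monom 1 (d - degree f) * reflect_poly f"

lemma coeff_reverse_poly:
  assumes "degree f \<le> d"
  shows "coeff (reverse_poly d f) i = (if i \<le> d then coeff f (d - i) else 0)"
  using assms by (auto simp: reverse_poly_def coeff_monom_mult coeff_reflect_poly coeff_eq_0)

lemma reverse_poly_lincomb:
  assumes "degree f \<le> d" "degree g \<le> d"
  shows "reverse_poly d (smult u f + smult v g) =
    smult u (reverse_poly d f) + smult v (reverse_poly d g)"
proof -
  have "degree (smult u f + smult v g) \<le> d"
    using assms by (intro degree_add_le) (auto intro: order_trans[OF degree_smult_le])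
  thus ?thesis
    using assms by (intro poly_eqI) (simp add: coeff_reverse_poly)
qed

lemma poly_reverse_poly:
  assumes "degree f \<le> d" "x \<noteq> 0"
  shows "poly (reverse_poly d f) x = x ^ d * poly f (inverse x)"
  using assms by (simp add: reverse_poly_def poly_monom poly_reflect_poly_nz flip: power_add mult.assoc)

lemma poly_reverse_poly_0:
  assumes "degree f \<le> d"
  shows "poly (reverse_poly d f) 0 = coeff f d"
  using assms by (simp add: poly_0_coeff_0 coeff_reverse_poly)

lemma reverse_poly_eq_0_iff [simp]: "reverse_poly d f = 0 \<longleftrightarrow> f = 0"
  by (simp add: reverse_poly_def)

lemma reverse_poly_no_common_root:
  assumes "Q \<noteq> 0" and ncr: "\<And>x. \<not> (poly P x = 0 \<and> poly Q x = 0)"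
    and d: "d = max (degree P) (degree Q)"
  shows "\<not> (poly (reverse_poly d P) x = 0 \<and> poly (reverse_poly d Q) x = 0)"
proof (cases "x = 0")
  case True
  have "coeff P d \<noteq> 0 \<or> coeff Q d \<noteq> 0"
    using d assms(1) by (auto simp: max_def)
  thus ?thesis
    using True d by (simp add: poly_reverse_poly_0)
next
  case False
  thus ?thesis
    using ncr[of "inverse x"] d by (simp add: poly_reverse_poly)
qed

text \<open>The chart \<open>1 / x\<close> around infinity, with 0 sent to
  \<open>None\<close>.\<close>

definition recip :: "'a \<Rightarrow> 'a option" where
  "recip x = proj 1 x"

lemma sph_recip:
  assumes "absv x \<le> 1" "absv y \<le> 1"
  shows "sph absv (recip x) (recip y) = absv (x - y)"
  using assms absv_diff_commute[of x y] by (simp add: recip_def sph_proj)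

lemma sph_Some_unit_disc:
  assumes "absv x \<le> 1" "absv y \<le> 1"
  shows "sph absv (Some x) (Some y) = absv (x - y)"
  using assms by simp

text \<open>Away from 0, both homogeneous coordinates get multiplied by \<open>x ^ d\<close>; at 0,
  the coefficients of degree \<open>d\<close> give the value at infinity.\<close>

lemma rat_eval_recip:
  assumes "Q \<noteq> 0" "d = max (degree P) (degree Q)"
  shows "rat_eval P Q (recip x) = rat_eval (reverse_poly d P) (reverse_poly d Q) (Some x)"
proof (cases "x = 0")
  case True
  thus ?thesis
    using assms rat_eval_None[OF assms(1), of P] unfolding rat_eval_Some
    by (simp add: recip_def proj_def poly_reverse_poly_0)
next
  case False
  hence "recip x = Some (inverse x)"
    by (simp add: recip_def proj_def inverse_eq_divide)
  thus ?thesis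
    using False assms proj_scale[of "x ^ d"] unfolding rat_eval_Some
    by (simp add: poly_reverse_poly rat_eval_Some del: rat_eval.simps)
qed

text \<open>The projective line is the union of the unit disc and its inverse, which share the unit
  circle. Two points not lying in a common one of these discs have distance 1.\<close>

lemma P1_pair_cases:
  assumes "x \<noteq> y"
  obtains (disc) a b where "x = Some a" "y = Some b" "absv a \<le> 1" "absv b \<le> 1" "a \<noteq> b"
    | (codisc) a b where "x = recip a" "y = recip b" "absv a \<le> 1" "absv b \<le> 1" "a \<noteq> b"
    | (far) "sph absv x y = 1"
proof -
  have out: "\<exists>a. z = recip a \<and> absv a < 1" if "\<nexists>a. z = Some a \<and> absv a \<le> 1" for z
  proof (cases z)
    case None
    thus ?thesis by (intro exI[of _ 0]) (simp add: recip_def proj_def)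
  next
    case (Some w)
    hence "1 < absv w" using that by (auto simp: not_le)
    moreover from this have "w \<noteq> 0" by auto
    ultimately show ?thesis using Some
      by (intro exI[of _ "1 / w"]) (simp add: recip_def proj_def absv_divide)
  qed
  \<comment> \<open>In homogeneous coordinates the determinant is \<open>a * b - 1\<close>, of
    absolute value 1 because \<open>absv (a * b) < 1\<close>, and both maxima in the denominator are
    1.\<close>
  have far': "sph absv (Some a) (recip b) = 1" "sph absv (recip b) (Some a) = 1"
    if "absv a \<le> 1" "absv b < 1" for a b
  proof -
    have a: "Some a = proj a 1" by (simp add: proj_def)
    have "absv (a * b) < 1"
      using that mult_left_le_one_le[of "absv b" "absv a"] by (simp add: absv_mult)
    hence "absv (a * b - 1) = 1" "absv (1 - a * b) = 1"
      using absv_add_eq[of "a * b" "-1"] absv_add_eq[of "- (a * b)" 1] by auto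
    thus "sph absv (Some a) (recip b) = 1" "sph absv (recip b) (Some a) = 1"
      using that unfolding a recip_def by (simp_all add: sph_proj max.absorb1 max.absorb2 mult.commute)
  qed
  consider a b where "x = Some a" "y = Some b" "absv a \<le> 1" "absv b \<le> 1"
    | a b where "x = Some a" "y = recip b" "absv a \<le> 1" "absv b < 1"
    | a b where "x = recip b" "y = Some a" "absv a \<le> 1" "absv b < 1"
    | a b where "x = recip a" "y = recip b" "absv a < 1" "absv b < 1"
    using out[of x] out[of y] by blast
  thus ?thesis
  proof cases
    case 1
    thus ?thesis using disc assms by auto
  next
    case 4
    thus ?thesis using codisc[of a b] assms by auto
  qed (use far far' in auto)
qed

text \<open>Pairs at distance 1 are harmless, since image distances are at most 1 and
  \<open>L\<close> is at least 1. All other pairs lie in one chart, where the spherical metric is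
  the plain distance.\<close>

lemma Lipschitz_from_unit_disc:
  assumes Q: "Q \<noteq> 0" and ncr: "\<And>x. \<not> (poly P x = 0 \<and> poly Q x = 0)"
    and d: "d = max (degree P) (degree Q)"
    and L: "1 \<le> L"
    and in_disc: "\<And>x y. absv x \<le> 1 \<Longrightarrow> absv y \<le> 1 \<Longrightarrow> x \<noteq> y \<Longrightarrow>
      sph absv (rat_eval P Q (Some x)) (rat_eval P Q (Some y)) \<le> L * absv (x - y)"
    and in_codisc: "\<And>x y. absv x \<le> 1 \<Longrightarrow> absv y \<le> 1 \<Longrightarrow> x \<noteq> y \<Longrightarrow>
      sph absv (rat_eval (reverse_poly d P) (reverse_poly d Q) (Some x))
        (rat_eval (reverse_poly d P) (reverse_poly d Q) (Some y)) \<le> L * absv (x - y)"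
    and xy: "x \<noteq> y"
  shows "sph absv (rat_eval P Q x) (rat_eval P Q y) \<le> L * sph absv x y"
  using xy
proof (cases rule: P1_pair_cases)
  case (disc a b)
  thus ?thesis using in_disc[of a b] sph_Some_unit_disc[of a b] by metis
next
  case (codisc a b)
  thus ?thesis
    using in_codisc[of a b] sph_recip[of a b] rat_eval_recip[OF Q d] by metis
next
  case far
  have ex: "\<exists>p q. rat_eval P Q z = proj p q \<and> (p \<noteq> 0 \<or> q \<noteq> 0)" for z
  proof (cases z)
    case None
    have "coeff P d \<noteq> 0 \<or> coeff Q d \<noteq> 0"
      using d Q by (auto simp: max_def)
    thus ?thesis
      using None rat_eval_None[OF Q, of P] d by blast
  next
    case (Some w)
    thus ?thesis using rat_eval_Some[of P Q w] ncr[of w] by blast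
  qed
  obtain p q p' q' where "rat_eval P Q x = proj p q" "p \<noteq> 0 \<or> q \<noteq> 0"
    "rat_eval P Q y = proj p' q'" "p' \<noteq> 0 \<or> q' \<noteq> 0"
    using ex[of x] ex[of y] by blast
  hence "sph absv (rat_eval P Q x) (rat_eval P Q y) \<le> 1"
    using sph_proj_le_1[of p q p' q'] by simp
  thus ?thesis using far L by simp
qed

text \<open>The image of \<open>s\<close> under inversion: \<open>reflect_poly f\<close> divided by
  \<open>X ^ degree f\<close> is \<open>f (1 / X)\<close>.\<close>

definition star :: "('a poly \<Rightarrow> real) \<Rightarrow> 'a poly \<Rightarrow> real" where
  "star s f = s (reflect_poly f) / s [:0, 1:] ^ degree f"

lemma star_reverse_poly:
  assumes s: "s \<in> H1 absv" and d: "degree f \<le> d"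
  shows "s (reverse_poly d f) = s [:0, 1:] ^ d * star s f"
proof -
  note b = H1_imp_berk_pt[OF s]
  have T: "0 < s [:0, 1:]" using s by (rule H1_pos) simp
  have "(monom 1 (d - degree f) :: 'a poly) = [:0, 1:] ^ (d - degree f)"
    by (simp add: monom_altdef)
  hence "s (reverse_poly d f) = s [:0, 1:] ^ (d - degree f) * s (reflect_poly f)"
    unfolding reverse_poly_def by (simp only: berk_mult[OF b] berk_power[OF b])
  also have "s [:0, 1:] ^ d = s [:0, 1:] ^ (d - degree f) * s [:0, 1:] ^ degree f"
    using d by (simp flip: power_add)
  ultimately show ?thesis
    using T by (simp add: star_def)
qed

text \<open>The degree of \<open>f + g\<close> may drop, so for the triangle inequality all three
  polynomials are reversed in one common degree.\<close>

lemma star_in_H1: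
  assumes s: "s \<in> H1 absv"
  shows "star s \<in> H1 absv"
proof -
  note b = H1_imp_berk_pt[OF s]
  have T: "0 < s [:0, 1:]" using s by (rule H1_pos) simp
  have add: "star s (f + g) \<le> star s f + star s g" for f g
  proof -
    define d where "d = max (degree f) (degree g)"
    have deg: "degree f \<le> d" "degree g \<le> d" "degree (f + g) \<le> d"
      by (auto simp: d_def degree_add_le)
    have "s (reverse_poly d (f + g)) \<le> s (reverse_poly d f) + s (reverse_poly d g)"
      using reverse_poly_lincomb[OF deg(1,2), of 1 1] berk_add[OF b] by simp
    hence "s [:0, 1:] ^ d * star s (f + g) \<le> s [:0, 1:] ^ d * (star s f + star s g)"
      using star_reverse_poly[OF s] deg by (simp add: distrib_left)
    thus ?thesis using T by simp
  qed
  have mult: "star s (f * g) = star s f * star s g" for f g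
  proof (cases "f = 0 \<or> g = 0")
    case False
    thus ?thesis
      by (simp add: star_def reflect_poly_mult berk_mult[OF b] degree_mult_eq power_add)
  qed (auto simp: star_def berk_zero[OF b])
  have "berk_pt absv (star s)"
    unfolding berk_pt_def using add mult berk_nonneg[OF b] T
    by (auto simp: star_def berk_const[OF b] intro!: divide_nonneg_nonneg)
  moreover have "\<not> type_I absv (star s)"
  proof
    assume "type_I absv (star s)"
    then obtain a where "star s [:-a, 1:] = absv (poly [:-a, 1:] a)"
      unfolding type_I_def by blast
    moreover have "0 < s (reflect_poly [:-a, 1:])"
      using s by (rule H1_pos) simp
    ultimately show False
      using T by (simp add: star_def)
  qed
  ultimately show ?thesis by (simp add: H1_def)
qed

text \<open>The reversed pair represents the map preceded by inversion, so its points over the Gauss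
  point are carried by inversion to those of \<open>P / Q\<close>.\<close>

lemma balanced_star:
  assumes s: "s \<in> H1 absv" and d: "degree P \<le> d" "degree Q \<le> d"
    and bal: "balanced (reverse_poly d P) (reverse_poly d Q) s"
  shows "balanced P Q (star s)"
  unfolding balanced_def
proof (intro allI)
  fix u v
  have T: "0 < s [:0, 1:]" using s by (rule H1_pos) simp
  have "degree (smult u P + smult v Q) \<le> d"
    using d by (intro degree_add_le) (auto intro: order_trans[OF degree_smult_le])
  hence "s [:0, 1:] ^ d * star s (smult u P + smult v Q) =
      s (smult u (reverse_poly d P) + smult v (reverse_poly d Q))"
    using star_reverse_poly[OF s, of "smult u P + smult v Q" d] reverse_poly_lincomb[OF d, of u v]
    by (metis (no_types))
  also have "\<dots> = max (absv u) (absv v) * (s [:0, 1:] ^ d * star s Q)"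
    using balancedD[OF bal] star_reverse_poly[OF s d(2)] by simp
  finally show "star s (smult u P + smult v Q) = max (absv u) (absv v) * star s Q"
    using T by simp
qed

section \<open>Bounds for the diameter\<close>

lemma bdd_below_linear:
  "s \<in> H1 absv \<Longrightarrow> bdd_below (range (\<lambda>b. s [:-b, 1:]))"
  using berk_nonneg[OF H1_imp_berk_pt] by (intro bdd_belowI2[of _ 0]) auto

lemma diam_G_le:
  assumes "s \<in> H1 absv"
  shows "diam_G absv s \<le> s [:-b, 1:] / (max 1 (s [:0, 1:]))\<^sup>2"
  unfolding diam_G_def
  by (intro divide_right_mono cINF_lower bdd_below_linear assms) auto

lemma diam_G_nonneg: "s \<in> H1 absv \<Longrightarrow> 0 \<le> diam_G absv s"
  unfolding diam_G_def
  by (intro divide_nonneg_nonneg cINF_greatest) (auto simp: berk_nonneg[OF H1_imp_berk_pt])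

lemma diam_G_le_1:
  assumes "s \<in> H1 absv"
  shows "diam_G absv s \<le> 1"
proof -
  have "s [:0, 1:] \<le> max 1 (s [:0, 1:]) * max 1 (s [:0, 1:])"
    using mult_left_mono[of 1 "max 1 (s [:0, 1:])" "max 1 (s [:0, 1:])"] by simp
  hence "s [:0, 1:] / (max 1 (s [:0, 1:]))\<^sup>2 \<le> 1"
    by (simp add: power2_eq_square)
  thus ?thesis
    using diam_G_le[OF assms, of 0] by (metis minus_zero order_trans)
qed

lemma diam_G_zeta:
  assumes "0 < r" "r \<le> 1" "absv c \<le> 1"
  shows "diam_G absv (zeta c r) \<le> r"
proof -
  have "zeta c r [:0, 1:] \<le> 1"
    using zeta_linear[of c r 0] assms by simp
  thus ?thesis
    using diam_G_le[OF zeta_in_H1[OF assms(1)], of c c] zeta_linear[of c r c] assms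
    by simp
qed

text \<open>Inversion turns the disc point into one centred at \<open>1 / c\<close> with radius
  \<open>r / absv c ^ 2\<close> if \<open>r \<le> absv c\<close>, and at 0 with radius
  \<open>1 / r\<close> otherwise. That centre is inserted into the infimum defining
  \<open>diam_G\<close>.\<close>

lemma diam_G_star_zeta:
  assumes "0 < r" "r \<le> 1" "absv c \<le> 1"
  shows "diam_G absv (star (zeta c r)) \<le> r"
proof -
  let ?s = "zeta c r"
  define m where "m = max (absv c) r"
  have m: "0 < m" "m \<le> 1" using assms by (auto simp: m_def)
  have T: "?s [:0, 1:] = m"
    using zeta_linear[of c r 0] by (simp add: m_def)
  have starT: "star ?s [:0, 1:] = 1 / m"
    using zeta_const[of c r 1] by (simp add: star_def T reflect_poly_pCons')
  have le: "diam_G absv (star ?s) \<le> star ?s [:-b, 1:] * m\<^sup>2" for b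
    using diam_G_le[OF star_in_H1[OF zeta_in_H1[OF assms(1)]], of c b] m
    unfolding starT by (simp add: max.absorb2 power_divide)
  show ?thesis
  proof (cases "r \<le> absv c")
    case True
    hence c: "c \<noteq> 0" "m = absv c" using assms by (auto simp: m_def)
    have "reflect_poly [:- (1 / c), 1:] = smult (- (1 / c)) [:- c, 1:]"
      using c by (simp add: reflect_poly_pCons)
    hence "?s (reflect_poly [:- (1 / c), 1:]) = absv (- (1 / c)) * r"
      using zeta_smult[OF assms(1), of c "- (1 / c)" "[:- c, 1:]"] zeta_linear[of c r c] assms(1)
      by simp
    hence "star ?s [:- (1 / c), 1:] = (r / m) / m"
      using c by (simp add: star_def T absv_divide)
    thus ?thesis
      using le[of "1 / c"] m by (simp add: power2_eq_square)
  next
    case False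
    hence "m = r" by (simp add: m_def)
    thus ?thesis
      using le[of 0] starT m by (simp add: power2_eq_square)
  qed
qed

subsection \<open>Upper bound\<close>


lemma poly_lipschitz_unit_disc:
  "\<exists>C>0. \<forall>x y. absv x \<le> 1 \<longrightarrow> absv y \<le> 1 \<longrightarrow>
    absv (poly f x) \<le> C \<and> absv (poly f x - poly f y) \<le> C * absv (x - y)"
proof (induction f)
  case 0
  show ?case by (intro exI[of _ 1]) simp
next
  case (pCons c f)
  then obtain C where C: "0 < C"
    "\<And>x y. absv x \<le> 1 \<Longrightarrow> absv y \<le> 1 \<Longrightarrow>
      absv (poly f x) \<le> C \<and> absv (poly f x - poly f y) \<le> C * absv (x - y)"
    by blast
  show ?case
  proof (intro exI[of _ "max (absv c) C"] conjI allI impI)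
    show "0 < max (absv c) C" using C by simp
    fix x y assume xy: "absv x \<le> 1" "absv y \<le> 1"
    have "absv (x * poly f x) \<le> 1 * C"
      unfolding absv_mult using xy C by (intro mult_mono) auto
    thus "absv (poly (pCons c f) x) \<le> max (absv c) C"
      using absv_add[of c "x * poly f x"] by auto
    have "absv (x * (poly f x - poly f y)) \<le> 1 * (C * absv (x - y))"
      unfolding absv_mult using xy C by (intro mult_mono) auto
    moreover have "absv ((x - y) * poly f y) \<le> absv (x - y) * C"
      unfolding absv_mult using xy C by (intro mult_mono) auto
    moreover have "poly (pCons c f) x - poly (pCons c f) y =
        x * (poly f x - poly f y) + (x - y) * poly f y"
      by (simp add: algebra_simps)
    ultimately have "absv (poly (pCons c f) x - poly (pCons c f) y) \<le> C * absv (x - y)"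
      using absv_add[of "x * (poly f x - poly f y)" "(x - y) * poly f y"] by (simp add: mult.commute)
    also have "\<dots> \<le> max (absv c) C * absv (x - y)"
      by (intro mult_right_mono) auto
    finally show "absv (poly (pCons c f) x - poly (pCons c f) y) \<le> max (absv c) C * absv (x - y)" .
  qed
qed

text \<open>Each linear factor contributes at least \<open>e\<close>, and the constant factor is
  nonzero.\<close>

lemma poly_bound_away_from_roots:
  assumes "0 < e" "f \<noteq> 0"
  shows "\<exists>C>0. \<forall>x. (\<forall>a. poly f a = 0 \<longrightarrow> e \<le> absv (x - a)) \<longrightarrow> C \<le> absv (poly f x)"
  using assms(2)
proof (induction f rule: poly_root_induct_closed)
  case (const c)
  thus ?case by (intro exI[of _ "absv c"]) simp
next
  case (linear b f)
  then obtain C where C: "0 < C"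
    "\<And>x. (\<And>a. poly f a = 0 \<Longrightarrow> e \<le> absv (x - a)) \<Longrightarrow> C \<le> absv (poly f x)"
    by blast
  show ?case
  proof (intro exI[of _ "e * C"] conjI allI impI)
    show "0 < e * C" using C assms by simp
    fix x assume "\<forall>a. poly ([:-b, 1:] * f) a = 0 \<longrightarrow> e \<le> absv (x - a)"
    hence "e \<le> absv (x - b)" "C \<le> absv (poly f x)"
      by (auto intro!: C(2))
    hence "e * C \<le> absv (x - b) * absv (poly f x)"
      using assms C by (intro mult_mono) auto
    thus "e * C \<le> absv (poly ([:-b, 1:] * f) x)"
      by (simp flip: absv_mult add: algebra_simps)
  qed
qed

text \<open>Let \<open>e\<close> be the least distance between a zero of \<open>P\<close> and a zero
  of \<open>Q\<close>, capped at 1. By the ultrametric inequality no point is closer than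
  \<open>e\<close> to zeros of both, so one of the polynomials is bounded away from 0 at it.\<close>

lemma no_common_root_bound:
  assumes "P \<noteq> 0" "Q \<noteq> 0" and ncr: "\<And>x. \<not> (poly P x = 0 \<and> poly Q x = 0)"
  shows "\<exists>C>0. \<forall>x. C \<le> max (absv (poly P x)) (absv (poly Q x))"
proof -
  define S where "S = (\<lambda>(a, b). absv (a - b)) ` ({a. poly P a = 0} \<times> {b. poly Q b = 0})"
  have fin: "finite (insert 1 S)"
    unfolding S_def using assms by (auto intro!: poly_roots_finite)
  define e where "e = Min (insert 1 S)"
  have "\<forall>z\<in>insert 1 S. 0 < z"
    using ncr by (auto simp: S_def)
  hence e: "0 < e"
    unfolding e_def using fin by (subst Min_gr_iff) auto
  have e_le: "e \<le> absv (a - b)" if "poly P a = 0" "poly Q b = 0" for a b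
    unfolding e_def using fin that by (intro Min_le) (auto simp: S_def)
  obtain C1 where C1: "0 < C1"
    "\<And>x. (\<And>a. poly P a = 0 \<Longrightarrow> e \<le> absv (x - a)) \<Longrightarrow> C1 \<le> absv (poly P x)"
    using poly_bound_away_from_roots[OF e assms(1)] by blast
  obtain C2 where C2: "0 < C2"
    "\<And>x. (\<And>a. poly Q a = 0 \<Longrightarrow> e \<le> absv (x - a)) \<Longrightarrow> C2 \<le> absv (poly Q x)"
    using poly_bound_away_from_roots[OF e assms(2)] by blast
  show ?thesis
  proof (intro exI[of _ "min C1 C2"] conjI allI)
    show "0 < min C1 C2" using C1 C2 by simp
    fix x
    show "min C1 C2 \<le> max (absv (poly P x)) (absv (poly Q x))"
    proof (cases "\<forall>a. poly P a = 0 \<longrightarrow> e \<le> absv (x - a)")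
      case True
      hence "C1 \<le> absv (poly P x)" by (intro C1(2)) auto
      thus ?thesis by linarith
    next
      case False
      then obtain a where a: "poly P a = 0" "absv (x - a) < e" by auto
      have "e \<le> absv (x - b)" if "poly Q b = 0" for b
        using e_le[OF a(1) that] a(2) absv_triangle[of a b x] absv_diff_commute[of x a] by auto
      hence "C2 \<le> absv (poly Q x)" by (rule C2(2))
      thus ?thesis by linarith
    qed
  qed
qed

text \<open>The constant is crude; only its existence matters, as together with
  \<open>diam_G_lower_bound\<close> it keeps the infimum \<open>GPR\<close> away from 0.\<close>

lemma rat_eval_lipschitz_unit_disc:
  assumes "P \<noteq> 0" "Q \<noteq> 0" and ncr: "\<And>x. \<not> (poly P x = 0 \<and> poly Q x = 0)"
  obtains C where "\<And>x y. absv x \<le> 1 \<Longrightarrow> absv y \<le> 1 \<Longrightarrow>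
    sph absv (rat_eval P Q (Some x)) (rat_eval P Q (Some y)) \<le> C * absv (x - y)"
proof -
  obtain A where A: "0 < A" "\<And>x y. absv x \<le> 1 \<Longrightarrow> absv y \<le> 1 \<Longrightarrow>
      absv (poly P x) \<le> A \<and> absv (poly P x - poly P y) \<le> A * absv (x - y)"
    using poly_lipschitz_unit_disc[of P] by blast
  obtain B where B: "0 < B" "\<And>x y. absv x \<le> 1 \<Longrightarrow> absv y \<le> 1 \<Longrightarrow>
      absv (poly Q x) \<le> B \<and> absv (poly Q x - poly Q y) \<le> B * absv (x - y)"
    using poly_lipschitz_unit_disc[of Q] by blast
  obtain c where c: "0 < c" "\<And>x. c \<le> max (absv (poly P x)) (absv (poly Q x))"
    using no_common_root_bound[OF assms] by blast
  show ?thesis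
  proof (rule that)
    fix x y assume xy: "absv x \<le> 1" "absv y \<le> 1"
    let ?X = "max (absv (poly P x)) (absv (poly Q x))" and ?Y = "max (absv (poly P y)) (absv (poly Q y))"
    have "absv ((poly P x - poly P y) * poly Q y) \<le> (A * absv (x - y)) * B"
      unfolding absv_mult using A B xy by (intro mult_mono) auto
    moreover have "absv (poly P y * (poly Q x - poly Q y)) \<le> A * (B * absv (x - y))"
      unfolding absv_mult using A B xy by (intro mult_mono) auto
    moreover have "poly P x * poly Q y - poly P y * poly Q x =
        (poly P x - poly P y) * poly Q y - poly P y * (poly Q x - poly Q y)"
      by (simp add: algebra_simps)
    ultimately have num: "absv (poly P x * poly Q y - poly P y * poly Q x) \<le> A * B * absv (x - y)"
      using absv_diff[of "(poly P x - poly P y) * poly Q y" "poly P y * (poly Q x - poly Q y)"]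
      by (simp add: mult_ac)
    have "sph absv (rat_eval P Q (Some x)) (rat_eval P Q (Some y)) =
        absv (poly P x * poly Q y - poly P y * poly Q x) / (?X * ?Y)"
      unfolding rat_eval_Some by (rule sph_proj) (use ncr in auto)
    also have "\<dots> \<le> (A * B * absv (x - y)) / (c * c)"
      using num c(1) c(2)[of x] c(2)[of y] A B by (intro frac_le mult_mono) auto
    finally show "sph absv (rat_eval P Q (Some x)) (rat_eval P Q (Some y)) \<le> A * B / (c * c) * absv (x - y)"
      by simp
  qed
qed

text \<open>A zero of \<open>P\<close> and a zero of \<open>Q\<close> suffice. If one polynomial is
  constant, subtracting the other makes it nonconstant, and a shear with \<open>c = 1\<close> undoes
  the change.\<close>

lemma ex_balanced:
  assumes "Q \<noteq> 0" and ncr: "\<And>x. \<not> (poly P x = 0 \<and> poly Q x = 0)"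
    and d: "0 < max (degree P) (degree Q)"
  obtains c r where "0 < r" "balanced P Q (zeta c r)"
proof -
  have two: "\<exists>c r. 0 < r \<and> balanced A B (zeta c r)"
    if "0 < degree A" "0 < degree B" "\<And>x. \<not> (poly A x = 0 \<and> poly B x = 0)" for A B
  proof -
    obtain a where a: "poly A a = 0" using \<open>0 < degree A\<close> by (rule ex_root)
    obtain b where b: "poly B b = 0" using \<open>0 < degree B\<close> by (rule ex_root)
    show ?thesis
      by (rule ex_balanced_between_zeros[OF a b order_refl that(3)]) blast+
  qed
  have "\<exists>c r. 0 < r \<and> balanced P Q (zeta c r)"
  proof (cases "degree P = 0 \<or> degree Q = 0")
    case False
    thus ?thesis using two ncr by simp
  next
    case True
    show ?thesis
    proof (cases "degree P = 0")
      case True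
      hence Q: "0 < degree Q" using d by simp
      hence "degree (P - Q) = degree Q"
        using True degree_add_eq_right[of P "- Q"] by simp
      hence "\<exists>c r. 0 < r \<and> balanced (P - Q) Q (zeta c r)"
        using Q ncr by (intro two) auto
      thus ?thesis using balanced_shear[of P 1 Q] by auto
    next
      case False
      hence "degree Q = 0" using True by simp
      hence "degree (Q - P) = degree P"
        using False degree_add_eq_right[of Q "- P"] by simp
      hence "\<exists>c r. 0 < r \<and> balanced (Q - P) P (zeta c r)"
        using False ncr by (intro two) auto
      thus ?thesis using balanced_shear[of Q 1 P] balanced_swap by fastforce
    qed
  qed
  thus ?thesis using that by blast
qed

text \<open>After exchanging \<open>P\<close> and \<open>Q\<close> if necessary, the image of
  \<open>x\<close> has absolute value at most 1, and subtracting it is a shear that moves the image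
  to 0.\<close>

lemma ex_balanced_in_disc:
  assumes ncr: "\<And>z. \<not> (poly P z = 0 \<and> poly Q z = 0)"
    and D: "D = sph absv (rat_eval P Q (Some x)) (rat_eval P Q (Some y))" "D \<noteq> 0"
  obtains c r where "absv (c - x) \<le> absv (x - y) / D" "0 < r" "r \<le> absv (x - y) / D"
    "balanced P Q (zeta c r)"
proof -
  let ?X = "max (absv (poly P x)) (absv (poly Q x))" and ?Y = "max (absv (poly P y)) (absv (poly Q y))"
  define N where "N = poly P x * poly Q y - poly P y * poly Q x"
  have D': "D = absv N / (?X * ?Y)"
    unfolding D N_def rat_eval_Some by (rule sph_proj) (use ncr in auto)
  hence N: "N \<noteq> 0" using D(2) by auto
  have *: "\<exists>c r. absv (c - x) \<le> absv (x - y) / D \<and> 0 < r \<and> r \<le> absv (x - y) / D \<and>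
      balanced A B (zeta c r)"
    if A0: "poly A x \<noteq> 0 \<or> poly B x \<noteq> 0"
      and le: "absv (poly A x) \<le> absv (poly B x)"
      and AB: "\<And>z. \<not> (poly A z = 0 \<and> poly B z = 0)"
      and DAB: "D = absv (poly A x * poly B y - poly A y * poly B x) /
        (absv (poly B x) * max (absv (poly A y)) (absv (poly B y)))" for A B
  proof -
    have Bx: "poly B x \<noteq> 0" using A0 le by auto
    define c where "c = poly A x / poly B x"
    have c: "absv c \<le> 1"
      using le Bx by (simp add: c_def absv_divide)
    define A' where "A' = A - smult c B"
    have A'x: "poly A' x = 0" using Bx by (simp add: A'_def c_def)
    have A'y: "poly A' y = - (poly A x * poly B y - poly A y * poly B x) / poly B x"
      using Bx by (simp add: A'_def c_def field_simps)
    have A'y0: "poly A' y \<noteq> 0"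
      using D(2) DAB Bx unfolding A'y by auto
    have "absv (c * poly B y) \<le> absv (poly B y)"
      using c by (simp add: absv_mult mult_left_le_one_le)
    \<comment> \<open>The shear is unimodular, so the factor belonging to \<open>y\<close> in the
      denominator of the distance does not change.\<close>
    hence max_eq: "max (absv (poly A' y)) (absv (poly B y)) = max (absv (poly A y)) (absv (poly B y))"
      using absv_diff[of "poly A y" "c * poly B y"] absv_add[of "poly A' y" "c * poly B y"]
      by (auto simp: A'_def)
    have R: "absv (x - y) / D =
        absv (x - y) * max (absv (poly A' y)) (absv (poly B y)) / absv (poly A' y)"
      unfolding max_eq unfolding A'y absv_divide absv_minus DAB by (simp add: field_simps)
    have ncr': "\<not> (poly A' z = 0 \<and> poly B z = 0)" for z
      using AB[of z] by (auto simp: A'_def)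
    obtain c' r where "absv (c' - x) \<le> absv (x - y) / D" "0 < r" "r \<le> absv (x - y) / D"
      "balanced A' B (zeta c' r)"
      by (rule ex_balanced_near_zero[OF A'x A'y0 ncr' R])
    thus ?thesis
      using balanced_shear[OF _ c, of A B] unfolding A'_def by blast
  qed
  show ?thesis
  proof (cases "absv (poly P x) \<le> absv (poly Q x)")
    case True
    have "\<exists>c r. absv (c - x) \<le> absv (x - y) / D \<and> 0 < r \<and> r \<le> absv (x - y) / D \<and>
        balanced P Q (zeta c r)"
      using ncr True D' by (intro *) (auto simp: N_def max.absorb2)
    thus ?thesis using that by blast
  next
    case False
    have "\<exists>c r. absv (c - x) \<le> absv (x - y) / D \<and> 0 < r \<and> r \<le> absv (x - y) / D \<and>
        balanced Q P (zeta c r)"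
    proof (rule *)
      show "D = absv (poly Q x * poly P y - poly Q y * poly P x) /
        (absv (poly P x) * max (absv (poly Q y)) (absv (poly P y)))"
        using D' False absv_minus[of N] by (simp add: N_def max.absorb1 max.commute mult.commute)
    qed (use ncr False in auto)
    thus ?thesis using that balanced_swap by blast
  qed
qed

text \<open>If the quotient of the distances reaches 1, \<open>G \<le> 1\<close> is enough.
  Otherwise the balanced disc has radius and centre in the range covered by
  \<open>radii\<close>.\<close>

lemma rat_eval_lipschitz_by_radii:
  assumes ncr: "\<And>z. \<not> (poly P z = 0 \<and> poly Q z = 0)"
    and G: "0 < G" "G \<le> 1"
    and radii: "\<And>c r. 0 < r \<Longrightarrow> r \<le> 1 \<Longrightarrow> absv c \<le> 1 \<Longrightarrow> balanced P Q (zeta c r) \<Longrightarrow> G \<le> r"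
    and xy: "absv x \<le> 1" "absv y \<le> 1"
  shows "sph absv (rat_eval P Q (Some x)) (rat_eval P Q (Some y)) \<le> 1 / G * absv (x - y)"
proof -
  define D where "D = sph absv (rat_eval P Q (Some x)) (rat_eval P Q (Some y))"
  have "0 \<le> D"
    unfolding D_def rat_eval_Some
    by (subst sph_proj) (use ncr in \<open>auto intro!: divide_nonneg_nonneg mult_nonneg_nonneg simp: le_max_iff_disj\<close>)
  consider "D = 0" | "0 < D" "1 \<le> absv (x - y) / D" | "0 < D" "absv (x - y) / D < 1"
    using \<open>0 \<le> D\<close> by linarith
  thus ?thesis
    unfolding D_def[symmetric]
  proof cases
    case 2
    hence "D \<le> absv (x - y)" by simp
    also have "\<dots> \<le> absv (x - y) / G"
      using G by (simp add: pos_le_divide_eq mult_left_le)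
    finally show "D \<le> 1 / G * absv (x - y)" by simp
  next
    case 3
    hence "D \<noteq> 0" by simp
    obtain c r where cr: "absv (c - x) \<le> absv (x - y) / D" "0 < r" "r \<le> absv (x - y) / D"
      "balanced P Q (zeta c r)"
      by (rule ex_balanced_in_disc[OF ncr D_def \<open>D \<noteq> 0\<close>])
    have "absv c \<le> 1"
      using absv_add[of "c - x" x] cr(1) 3(2) xy(1) unfolding diff_add_cancel by linarith
    moreover have "r \<le> 1" using cr(3) 3(2) by linarith
    ultimately have "G \<le> r"
      using radii cr by blast
    hence "G \<le> absv (x - y) / D" using cr by simp
    thus "D \<le> 1 / G * absv (x - y)"
      using 3 G by (simp add: field_simps)
  qed (use G in simp)
qed

subsection \<open>Lower bound\<close>


lemma ex_generic_point:
  assumes s: "s \<in> H1 absv" and B: "finite B" and t: "0 < t" "t < 1"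
    and eta: "(INF b. s [:-b, 1:]) < eta"
  obtains x where "s [:-x, 1:] \<le> eta"
    "\<And>b. b \<in> B \<Longrightarrow> t * s [:-b, 1:] \<le> absv (x - b) \<and> absv (x - b) \<le> s [:-b, 1:]"
proof -
  note bp = H1_imp_berk_pt[OF s]
  define I where "I = (INF b. s [:-b, 1:])"
  have I_le: "I \<le> s [:-b, 1:]" for b
    unfolding I_def by (intro cINF_lower bdd_below_linear s) simp
  show ?thesis
  proof (cases "\<exists>b\<in>B. s [:-b, 1:] = I")
    case True
    then obtain b0 where b0: "s [:-b0, 1:] = I" by blast
    hence I0: "0 < I" using H1_pos[OF s, of "[:-b0, 1:]"] by simp
    \<comment> \<open>The value group may omit \<open>I\<close>, so \<open>w\<close> only
      approximates it; this is where the loss \<open>t\<close> arises. A unit multiple of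
      \<open>w\<close> then steers \<open>x\<close> away from all of \<open>B\<close>.\<close>
    obtain w where w: "w \<noteq> 0" "t * I < absv w" "absv w \<le> I"
      by (rule value_group_dense[OF I0 t])
    obtain u where u: "absv u \<le> 1" "\<And>b. b \<in> (\<lambda>b. (b - b0) / w) ` B \<Longrightarrow> 1 \<le> absv (u - b)"
      using ex_unit_distant[of "(\<lambda>b. (b - b0) / w) ` B"] B by blast
    define x where "x = b0 + w * u"
    have "absv w * absv u \<le> I"
      using mult_left_le[OF u(1), of "absv w"] w absv_nonneg[of w] by linarith
    hence sx: "s [:-x, 1:] \<le> I"
      using berk_linear_shift[OF bp, of x b0] b0 by (simp add: x_def absv_mult)
    show ?thesis
    proof (rule that)
      show "s [:-x, 1:] \<le> eta" using sx eta by (simp add: I_def)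
      fix b assume b: "b \<in> B"
      have "x - b = w * (u - (b - b0) / w)"
        using w by (simp add: x_def field_simps)
      moreover have "absv w * 1 \<le> absv w * absv (u - (b - b0) / w)"
        using u(2) b by (intro mult_left_mono) auto
      ultimately have xb: "absv w \<le> absv (x - b)"
        by (simp add: absv_mult)
      have "t * s [:-b, 1:] \<le> absv (x - b)"
      proof (cases "s [:-b, 1:] \<le> absv (x - b)")
        case True
        have "t * s [:-b, 1:] \<le> s [:-b, 1:]"
          using t berk_nonneg[OF bp] by (intro mult_left_le_one_le) auto
        thus ?thesis using True by linarith
      next
        case False
        hence "s [:-b, 1:] \<le> I"
          using berk_linear_shift[OF bp, of b x] sx by linarith
        hence "t * s [:-b, 1:] \<le> t * I"
          using t by (intro mult_left_mono) auto
        thus ?thesis using w xb by linarith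
      qed
      moreover have "absv (x - b) \<le> s [:-b, 1:]"
        using berk_linear_diff[OF bp, of x b] sx I_le[of b] by linarith
      ultimately show "t * s [:-b, 1:] \<le> absv (x - b) \<and> absv (x - b) \<le> s [:-b, 1:]" by simp
    qed
  next
    case False
    \<comment> \<open>No element of \<open>B\<close> attains the infimum, so some \<open>x\<close>
      is nearer to \<open>s\<close> than all of \<open>B\<close>; then \<open>absv (x - b)\<close>
      even equals \<open>s [:-b, 1:]\<close>. Type IV points fall under this case.\<close>
    define m where "m = Min (insert eta ((\<lambda>b. s [:-b, 1:]) ` B))"
    have "I < m"
      unfolding m_def using B eta False I_le by (subst Min_gr_iff) (force simp: I_def order.strict_iff_order)+
    then obtain x where x: "s [:-x, 1:] < m"
      unfolding I_def by (subst (asm) cINF_less_iff) (auto intro: bdd_below_linear s)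
    show ?thesis
    proof (rule that)
      have "m \<le> eta" unfolding m_def using B by (intro Min_le) auto
      thus "s [:-x, 1:] \<le> eta" using x by simp
      fix b assume b: "b \<in> B"
      have "m \<le> s [:-b, 1:]" unfolding m_def using B b by (intro Min_le) auto
      hence xb: "s [:-x, 1:] < s [:-b, 1:]" using x by simp
      have "t * s [:-b, 1:] \<le> s [:-b, 1:]"
        using t berk_nonneg[OF bp] by (intro mult_left_le_one_le) auto
      thus "t * s [:-b, 1:] \<le> absv (x - b) \<and> absv (x - b) \<le> s [:-b, 1:]"
        using berk_linear_shift[OF bp, of b x] berk_linear_diff[OF bp, of x b] xb by linarith
    qed
  qed
qed

text \<open>The estimates for the linear factors multiply, with one factor \<open>t\<close> lost per
  root.\<close>

lemma poly_at_generic_point: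
  assumes s: "s \<in> H1 absv" and t: "0 < t" "t < 1" and f: "f \<noteq> 0"
    and x: "\<And>b. poly f b = 0 \<Longrightarrow> t * s [:-b, 1:] \<le> absv (x - b) \<and> absv (x - b) \<le> s [:-b, 1:]"
  shows "t ^ degree f * s f \<le> absv (poly f x) \<and> absv (poly f x) \<le> s f"
  using f x
proof (induction f rule: poly_root_induct_closed)
  case (const c)
  thus ?case using berk_const[OF H1_imp_berk_pt[OF s]] by simp
next
  case (linear b f)
  note bp = H1_imp_berk_pt[OF s]
  have b: "t * s [:-b, 1:] \<le> absv (x - b)" "absv (x - b) \<le> s [:-b, 1:]"
    using linear.prems(2)[of b] by (simp_all del: mult_pCons_left)
  have f: "t ^ degree f * s f \<le> absv (poly f x)" "absv (poly f x) \<le> s f"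
    using linear.IH linear.hyps linear.prems(2) by (simp_all del: mult_pCons_left)
  have deg: "degree ([:-b, 1:] * f) = Suc (degree f)"
    using linear.hyps by (subst degree_mult_eq) auto
  have eval: "absv (poly ([:-b, 1:] * f) x) = absv (x - b) * absv (poly f x)"
    by (simp flip: absv_mult add: algebra_simps)
  have "t ^ Suc (degree f) * (s [:-b, 1:] * s f) = (t * s [:-b, 1:]) * (t ^ degree f * s f)"
    by (simp add: mult_ac)
  also have "(t * s [:-b, 1:]) * (t ^ degree f * s f) \<le> absv (x - b) * absv (poly f x)"
    using b f t berk_nonneg[OF bp] by (intro mult_mono) auto
  finally have "t ^ Suc (degree f) * (s [:-b, 1:] * s f) \<le> absv (x - b) * absv (poly f x)"
    by simp
  moreover have "absv (x - b) * absv (poly f x) \<le> s [:-b, 1:] * s f"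
    using b f berk_nonneg[OF bp] by (intro mult_mono) auto
  ultimately show ?case
    by (simp only: deg eval berk_mult[OF bp] simp_thms)
qed

lemma diam_G_lower_bound:
  assumes s: "s \<in> H1 absv" and Q: "Q \<noteq> 0" and bal: "balanced P Q s"
    and lip: "\<And>x y. x \<noteq> y \<Longrightarrow> sph absv (rat_eval P Q x) (rat_eval P Q y) \<le> L * sph absv x y"
  shows "1 \<le> L * diam_G absv s"
proof -
  note bp = H1_imp_berk_pt[OF s]
  define m where "m = s Q"
  define M where "M = max 1 (s [:0, 1:])"
  define d where "d = max (degree P) (degree Q)"
  have m: "0 < m" using H1_pos[OF s Q] by (simp add: m_def)
  have M: "1 \<le> M" by (simp add: M_def)
  have sP: "s P = m" using balanced_eq[OF bal] by (simp add: m_def)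
  have P: "P \<noteq> 0" using sP m berk_zero[OF bp] by auto
  have main: "0 < L \<and> t ^ (d + 2) * M\<^sup>2 \<le> L * eta"
    if t: "0 < t" "t < 1" and eta: "(INF b. s [:-b, 1:]) < eta" for t eta
  proof -
    \<comment> \<open>The element 0 is included so that \<open>absv x\<close> and
      \<open>absv y\<close> approximate \<open>s [:0, 1:]\<close>, which controls the denominator of
      their spherical distance.\<close>
    define B where "B = insert 0 ({b. poly P b = 0} \<union> {b. poly Q b = 0})"
    have finB: "finite B"
      using P Q by (auto simp: B_def poly_roots_finite)
    obtain x where x: "s [:-x, 1:] \<le> eta"
      "\<And>b. b \<in> B \<Longrightarrow> t * s [:-b, 1:] \<le> absv (x - b) \<and> absv (x - b) \<le> s [:-b, 1:]"
      using ex_generic_point[OF s finB t eta] by blast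
    have "0 < t ^ degree Q * s Q" using m t by (simp add: m_def)
    moreover have "t ^ degree Q * s Q \<le> absv (poly Q x)"
      using poly_at_generic_point[OF s t Q, of x] x(2) by (auto simp: B_def)
    ultimately have Qx: "poly Q x \<noteq> 0" by auto
    define X where "X = max (absv (poly P x)) (absv (poly Q x))"
    have X: "0 < X" using Qx by (simp add: X_def less_max_iff_disj)
    \<comment> \<open>Up to sign, \<open>poly F y\<close> is the determinant in the distance of the
      images, and balance computes \<open>s F\<close>. Choosing \<open>y\<close> generic for
      \<open>F\<close> as well makes this distance nearly 1.\<close>
    define F where "F = smult (poly Q x) P + smult (- poly P x) Q"
    have sF: "s F = X * m"
      unfolding F_def balancedD[OF bal] by (simp add: X_def m_def max.commute)
    have F: "F \<noteq> 0" using sF X m berk_zero[OF bp] by auto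
    have finF: "finite (B \<union> {b. poly F b = 0})"
      using finB F by (simp add: poly_roots_finite)
    obtain y where y: "s [:-y, 1:] \<le> eta"
      "\<And>b. b \<in> B \<union> {b. poly F b = 0} \<Longrightarrow>
        t * s [:-b, 1:] \<le> absv (y - b) \<and> absv (y - b) \<le> s [:-b, 1:]"
      using ex_generic_point[OF s finF t eta] by blast
    have Fy: "t ^ degree F * s F \<le> absv (poly F y)"
      using poly_at_generic_point[OF s t F, of y] y(2) by auto
    have "degree F \<le> d"
      unfolding F_def d_def by (intro degree_add_le) (auto intro: order_trans[OF degree_smult_le])
    \<comment> \<open>\<open>degree F\<close> depends on \<open>x\<close>, and thereby on
      \<open>t\<close>; the exponent \<open>d\<close> is uniform, as the limit in \<open>t\<close>
      requires.\<close>
    hence "t ^ d * s F \<le> t ^ degree F * s F"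
      using t berk_nonneg[OF bp] by (intro mult_right_mono power_decreasing) auto
    with Fy have Fy': "t ^ d * (X * m) \<le> absv (poly F y)" by (simp add: sF)
    define Y where "Y = max (absv (poly P y)) (absv (poly Q y))"
    have Y: "Y \<le> m"
      using poly_at_generic_point[OF s t Q, of y] poly_at_generic_point[OF s t P, of y] y(2) sP
      by (auto simp: B_def m_def Y_def)
    have "t ^ degree Q * s Q \<le> absv (poly Q y)"
      using poly_at_generic_point[OF s t Q, of y] y(2) by (auto simp: B_def)
    with \<open>0 < t ^ degree Q * s Q\<close> have Qy: "poly Q y \<noteq> 0" by auto
    hence Y0: "0 < Y" by (simp add: Y_def less_max_iff_disj)
    have "0 < t ^ d * (X * m)" using t X m by simp
    with Fy' have "poly F y \<noteq> 0" by auto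
    moreover have "poly F x = 0" by (simp add: F_def)
    ultimately have xy: "x \<noteq> y" by auto
    have "poly P x * poly Q y - poly P y * poly Q x = - poly F y"
      by (simp add: F_def algebra_simps)
    hence "sph absv (rat_eval P Q (Some x)) (rat_eval P Q (Some y)) = absv (poly F y) / (X * Y)"
      unfolding rat_eval_Some X_def Y_def using Qx Qy by (subst sph_proj) auto
    also have "\<dots> \<ge> (t ^ d * (X * m)) / (X * m)"
      using Fy' X Y Y0 m t by (intro frac_le mult_left_mono) auto
    finally have low: "t ^ d \<le> sph absv (rat_eval P Q (Some x)) (rat_eval P Q (Some y))"
      using X m by simp
    have big: "t * M \<le> max 1 (absv z)" if "t * s [:-0, 1:] \<le> absv (z - 0)" for z
      using that t by (auto simp: M_def max_def)
    have bx: "t * M \<le> max 1 (absv x)" and by': "t * M \<le> max 1 (absv y)"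
      using big x(2)[of 0] y(2)[of 0] by (auto simp: B_def)
    have "absv (x - y) \<le> eta"
      using berk_linear_diff[OF bp, of x y] x(1) y(1) by linarith
    hence up: "sph absv (Some x) (Some y) \<le> eta / (t * M)\<^sup>2"
      unfolding sph.simps power2_eq_square using bx by' t M
      by (intro frac_le mult_mono) (auto intro: order_trans[OF absv_nonneg])
    have pos: "0 < sph absv (Some x) (Some y)"
      using xy by (auto intro!: divide_pos_pos mult_pos_pos simp: less_max_iff_disj)
    have le: "t ^ d \<le> L * sph absv (Some x) (Some y)"
      using low lip[of "Some x" "Some y"] xy by (auto intro: order_trans)
    hence L: "0 < L"
      using t pos by (metis less_le_trans zero_less_mult_pos2 zero_less_power)
    have "t ^ d \<le> L * (eta / (t * M)\<^sup>2)"
      using le up L mult_left_mono[OF up, of L] by linarith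
    hence "t ^ d * (t * M)\<^sup>2 \<le> L * eta"
      using t M by (simp add: field_simps)
    thus ?thesis using L by (simp add: power_add power_mult_distrib power2_eq_square mult_ac)
  qed
  have L: "0 < L"
    using main[of "1 / 2" "(INF b. s [:-b, 1:]) + 1"] by simp
  \<comment> \<open>Letting \<open>t\<close> tend to 1 removes the losses from approximate
    genericity; afterwards \<open>eta\<close> descends to the infimum.\<close>
  have M_le: "M\<^sup>2 \<le> L * eta" if eta: "(INF b. s [:-b, 1:]) < eta" for eta
  proof (rule tendsto_upperbound)
    show "((\<lambda>t. t ^ (d + 2) * M\<^sup>2) \<longlongrightarrow> M\<^sup>2) (at_left 1)"
      by (auto intro!: tendsto_eq_intros)
    show "\<forall>\<^sub>F t in at_left 1. t ^ (d + 2) * M\<^sup>2 \<le> L * eta"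
      using main eta by (intro eventually_at_leftI[of 0]) auto
  qed simp
  have "M\<^sup>2 / L \<le> eta" if "(INF b. s [:-b, 1:]) < eta" for eta
    using M_le[OF that] L by (simp only: pos_divide_le_eq mult.commute)
  hence "M\<^sup>2 / L \<le> (INF b. s [:-b, 1:])"
    by (rule dense_ge)
  hence "1 * M\<^sup>2 \<le> L * (INF b. s [:-b, 1:])"
    using L by (simp only: pos_divide_le_eq mult.commute mult_1)
  moreover have "0 < M\<^sup>2" using M by simp
  ultimately have "1 \<le> L * (INF b. s [:-b, 1:]) / M\<^sup>2"
    by (simp only: pos_le_divide_eq)
  thus ?thesis
    by (simp add: diam_G_def M_def)
qed

end

section \<open>Comparison of the Lipschitz constant with the Gauss pre-image radius\<close>

theorem theorem3:
  fixes absv :: "'a::field \<Rightarrow> real" and P Q :: "'a poly"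
  assumes "nonarch_abs absv" and "nontrivial_abs absv" and "complete_abs absv"
    and "alg_closed TYPE('a)"
    and "Q \<noteq> 0" and "coprime P Q" and "max (degree P) (degree Q) \<ge> 1"
  shows "Lip_P1 absv P Q = ereal (1 / GPR absv P Q)"
proof -
  interpret nonarch_acf absv
    using assms by unfold_locales
  define d where "d = max (degree P) (degree Q)"
  have d: "0 < d" using assms(7) by (simp add: d_def)
  note Q = \<open>Q \<noteq> 0\<close>
  have P: "P \<noteq> 0"
  proof
    assume "P = 0"
    hence "is_unit Q" using \<open>coprime P Q\<close> by simp
    hence "degree Q = 0" using is_unit_iff_degree[OF Q] by simp
    thus False using d \<open>P = 0\<close> by (simp add: d_def)
  qed
  have ncr: "\<not> (poly P x = 0 \<and> poly Q x = 0)" for x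
  proof
    assume "poly P x = 0 \<and> poly Q x = 0"
    hence "[:-x, 1:] dvd P" "[:-x, 1:] dvd Q"
      by (auto simp: poly_eq_0_iff_dvd)
    hence "is_unit [:-x, 1:]"
      using \<open>coprime P Q\<close> coprime_common_divisor by blast
    thus False
      using is_unit_iff_degree[of "[:-x, 1:]"] by simp
  qed
  let ?P = "reverse_poly d P" and ?Q = "reverse_poly d Q"
  have ncr': "\<not> (poly ?P x = 0 \<and> poly ?Q x = 0)" for x
    by (rule reverse_poly_no_common_root[OF Q ncr d_def])
  define S where "S = {s \<in> H1 absv. balanced P Q s}"
  define G where "G = GPR absv P Q"
  have G_eq: "G = Inf (diam_G absv ` S)"
    unfolding G_def GPR_def S_def using berk_act_eq_gauss_pt_iff[OF _ Q]
    by (metis (mono_tags, lifting) Collect_cong)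
  have G_le: "G \<le> diam_G absv s" if "s \<in> S" for s
    unfolding G_eq using that
    by (intro cINF_lower bdd_belowI2[of _ 0]) (auto simp: S_def diam_G_nonneg)
  have "\<exists>s. s \<in> S"
    using ex_balanced[OF Q ncr d[unfolded d_def]] zeta_in_H1 unfolding S_def by blast
  then obtain s0 where s0: "s0 \<in> S" by blast
  have G_le_1: "G \<le> 1"
    using G_le[OF s0] diam_G_le_1[of s0] s0 by (simp add: S_def)
  \<comment> \<open>Any Lipschitz constant \<open>L\<close> bounds all diameters, and with them
    their infimum, below by \<open>1 / L\<close>.\<close>
  have G_ge: "1 \<le> L * G"
    if lip: "\<And>x y. x \<noteq> y \<Longrightarrow> sph absv (rat_eval P Q x) (rat_eval P Q y) \<le> L * sph absv x y" for L
  proof -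
    have diam: "1 \<le> L * diam_G absv s" if "s \<in> S" for s
      using that lip by (intro diam_G_lower_bound[OF _ Q]) (auto simp: S_def)
    have L: "0 < L"
      using diam[OF s0] diam_G_nonneg[of s0] s0 by (intro ccontr[of "0 < L"])
        (auto simp: S_def not_less dest: mult_nonpos_nonneg)
    have "1 / L \<le> G"
      unfolding G_eq using diam L s0 by (intro cINF_greatest) (auto simp: field_simps)
    thus ?thesis using L by (simp add: field_simps)
  qed
  obtain C1 where C1: "\<And>x y. absv x \<le> 1 \<Longrightarrow> absv y \<le> 1 \<Longrightarrow>
      sph absv (rat_eval P Q (Some x)) (rat_eval P Q (Some y)) \<le> C1 * absv (x - y)"
    using rat_eval_lipschitz_unit_disc[OF P Q ncr] by blast
  obtain C2 where C2: "\<And>x y. absv x \<le> 1 \<Longrightarrow> absv y \<le> 1 \<Longrightarrow>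
      sph absv (rat_eval ?P ?Q (Some x)) (rat_eval ?P ?Q (Some y)) \<le> C2 * absv (x - y)"
    using rat_eval_lipschitz_unit_disc[OF _ _ ncr'] P Q by (metis reverse_poly_eq_0_iff)
  define C where "C = max 1 (max C1 C2)"
  have C_ge: "C1 * absv z \<le> C * absv z" "C2 * absv z \<le> C * absv z" for z
    by (auto simp: C_def intro!: mult_right_mono)
  \<comment> \<open>Existence of some Lipschitz constant forces \<open>G\<close> to be positive,
    after which \<open>1 / G\<close> can serve as one.\<close>
  have "1 \<le> C * G"
  proof (rule G_ge, rule Lipschitz_from_unit_disc[OF Q ncr d_def])
    show "1 \<le> C" by (simp add: C_def)
  qed (use C1 C2 C_ge order_trans in blast)+
  moreover have "0 \<le> C" by (simp add: C_def)
  ultimately have G0: "0 < G"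
    using mult_nonneg_nonpos[of C G] by linarith
  have upper: "sph absv (rat_eval P Q x) (rat_eval P Q y) \<le> 1 / G * sph absv x y"
    if "x \<noteq> y" for x y
    using that
  proof (intro Lipschitz_from_unit_disc[OF Q ncr d_def])
    show "1 \<le> 1 / G" using G0 G_le_1 by simp
  next
    fix x y assume xy: "absv x \<le> 1" "absv y \<le> 1"
    have "G \<le> r" if "0 < r" "r \<le> 1" "absv c \<le> 1" "balanced P Q (zeta c r)" for c r
      using G_le[of "zeta c r"] that zeta_in_H1[OF that(1)] diam_G_zeta[OF that(1-3)]
      by (simp add: S_def)
    thus "sph absv (rat_eval P Q (Some x)) (rat_eval P Q (Some y)) \<le> 1 / G * absv (x - y)"
      by (rule rat_eval_lipschitz_by_radii[OF ncr G0 G_le_1 _ xy])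
  next
    fix x y assume xy: "absv x \<le> 1" "absv y \<le> 1"
    \<comment> \<open>In the chart at infinity a balanced disc for the reversed pair is carried back
      by \<open>star\<close>, which yields a point over the Gauss point of diameter at most
      \<open>r\<close>.\<close>
    have "G \<le> r" if "0 < r" "r \<le> 1" "absv c \<le> 1" "balanced ?P ?Q (zeta c r)" for c r
    proof -
      have "balanced P Q (star (zeta c r))"
        using zeta_in_H1[OF that(1)] that(4) by (intro balanced_star) (auto simp: d_def)
      thus ?thesis
        using G_le[of "star (zeta c r)"] star_in_H1[OF zeta_in_H1[OF that(1)]]
          diam_G_star_zeta[OF that(1-3)]
        by (simp add: S_def)
    qed
    thus "sph absv (rat_eval ?P ?Q (Some x)) (rat_eval ?P ?Q (Some y)) \<le> 1 / G * absv (x - y)"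
      by (rule rat_eval_lipschitz_by_radii[OF ncr' G0 G_le_1 _ xy])
  qed
  have sph_pos: "0 < sph absv x y" if "x \<noteq> y" for x y
    using that by (cases x; cases y) (auto intro!: divide_pos_pos mult_pos_pos simp: less_max_iff_disj)
  have ratio_le: "sph absv (rat_eval P Q x) (rat_eval P Q y) / sph absv x y \<le> L \<longleftrightarrow>
      sph absv (rat_eval P Q x) (rat_eval P Q y) \<le> L * sph absv x y" if "x \<noteq> y" for x y L
    using sph_pos[OF that] by (simp add: pos_divide_le_eq)
  have le: "Lip_P1 absv P Q \<le> ereal (1 / G)"
    unfolding Lip_P1_def using upper ratio_le by (intro SUP_least) auto
  have ge_ratio: "ereal (sph absv (rat_eval P Q x) (rat_eval P Q y) / sph absv x y) \<le> Lip_P1 absv P Q"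
    if "x \<noteq> y" for x y
    unfolding Lip_P1_def using that by (intro SUP_upper2[of "(x, y)"]) auto
  \<comment> \<open>One pair of distinct points bounds the supremum below and \<open>1 / G\<close>
    bounds it above, so it is a real number, and \<open>G_ge\<close> applies to it.\<close>
  have "Some 0 \<noteq> (None :: 'a option)" by simp
  from ge_ratio[OF this] le obtain L where L: "Lip_P1 absv P Q = ereal L"
    by (cases "Lip_P1 absv P Q") auto
  have "1 \<le> L * G"
    using ge_ratio ratio_le by (intro G_ge) (auto simp: L)
  hence "1 / G \<le> L"
    using G0 by (simp add: pos_divide_le_eq)
  thus ?thesis
    using le by (simp add: L G_def[symmetric])
qed

end
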